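(* Let $\sigma\in(0,\infty)$. Let $\Omega\subset\mathbb{R}^d$ ($d\ge 1$) be a bounded domain (bounded connected open set) with $C^{2,\alpha}$ boundary for some $\alpha\in(0,1)$, with unit outer normal $\nu$. Let $h=h(x,m):\Omega\times(0,\infty)\to\mathbb{R}$ satisfy: (i) $h(x,\cdot)$ is increasing (i.e. nondecreasing) for every $x\in\Omega$; (ii) there is a continuous $g:(0,\infty)\to[0,\infty)$ with $\sup_{x\in\Omega}|h(x,m)|\le g(m)$ for every $m\in(0,\infty)$; (iii) $h\in C^2(\Omega\times(0,\infty))\cap C^1(\bar\Omega\times(0,\infty))$; (iv) there is a continuous $f:(0,\infty)\to[0,\infty)$ with $\sup_{x\in\Omega}|\nabla_x h(x,m)|\le f(m)$ for every $m\in(0,\infty)$. Then there exists a unique function $m:\Omega\to(0,\infty)$ with $m\in C^2(\Omega)\cap C^1(\bar\Omega)$ such that $$-\frac{\sigma^2}{2}\nabla^2 m-\nabla\cdot\big(m\nabla[h(x,m)]\big)=0\quad (x\in\Omega),$$ $$-\frac{\sigma^2}{2}\nabla m\cdot\nu-m\nabla[h(x,m)]\cdot\nu=0\quad (x\in\partial\Omega),$$ $$\int_\Omega m\,dx=1.$$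
   Context: $\nabla^2$ denotes the Laplacian. $\nabla[h(x,m)]$ denotes the (total) gradient of the function $x\mapsto h(x,m(x))$, whereas $\nabla_x h$ is the partial gradient in the first variable. A function is in $C^1(\bar\Omega)$ if it and its first derivatives extend continuously to $\bar\Omega$; likewise for $C^1(\bar\Omega\times(0,\infty))$. The system is the stationary best reply strategy (BRS) boundary value problem. *)

theory Defs
  imports "HOL-Analysis.Analysis"
begin

section \<open>Differential operators\<close>

definition partial :: "'a::euclidean_space \<Rightarrow> ('a \<Rightarrow> 'b::real_normed_vector) \<Rightarrow> 'a \<Rightarrow> 'b" where
  "partial b f x = frechet_derivative f (at x) b"

definition grad :: "('a::euclidean_space \<Rightarrow> real) \<Rightarrow> 'a \<Rightarrow> 'a" where
  "grad u x = (\<Sum>b\<in>Basis. partial b u x *\<^sub>R b)"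

definition divergence :: "('a::euclidean_space \<Rightarrow> 'a) \<Rightarrow> 'a \<Rightarrow> real" where
  "divergence F x = (\<Sum>b\<in>Basis. partial b F x \<bullet> b)"

definition laplacian :: "('a::euclidean_space \<Rightarrow> real) \<Rightarrow> 'a \<Rightarrow> real" where
  "laplacian u x = (\<Sum>b\<in>Basis. partial b (partial b u) x)"

lemma grad_eqI:
  assumes "GDERIV u x :> D"
  shows "grad u x = D"
proof -
  have "frechet_derivative u (at x) = (\<lambda>v. v \<bullet> D)"
    using assms frechet_derivative_at unfolding gderiv_def by metis
  then show ?thesis
    by (simp add: grad_def partial_def inner_commute[of _ D] euclidean_representation)
qed


section \<open>Function spaces\<close>

text \<open>
  The sets \<open>S\<close> below are open: all derivatives are taken in the full space.
\<close>

primrec Ck_on :: "nat \<Rightarrow> 'a::euclidean_space set \<Rightarrow> ('a \<Rightarrow> 'b::real_normed_vector) \<Rightarrow> bool" where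
  "Ck_on 0 S f \<longleftrightarrow> continuous_on S f"
| "Ck_on (Suc k) S f \<longleftrightarrow>
     (\<forall>x\<in>S. f differentiable (at x)) \<and> (\<forall>b\<in>Basis. Ck_on k S (partial b f))"

definition holder_on :: "real \<Rightarrow> 'a::metric_space set \<Rightarrow> ('a \<Rightarrow> 'b::metric_space) \<Rightarrow> bool" where
  "holder_on \<alpha> K f \<longleftrightarrow> (\<exists>C. \<forall>x\<in>K. \<forall>y\<in>K. dist (f x) (f y) \<le> C * dist x y powr \<alpha>)"

text \<open>
  As in Gilbarg and Trudinger, membership in \<open>C\<^sup>k\<^sup>,\<^sup>\<alpha>(S)\<close> for open \<open>S\<close> asks for Hoelder continuity
  of the derivatives of order \<open>k\<close> on compact subsets of \<open>S\<close> only.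
\<close>

primrec Ck_holder_on ::
  "nat \<Rightarrow> real \<Rightarrow> 'a::euclidean_space set \<Rightarrow> ('a \<Rightarrow> 'b::real_normed_vector) \<Rightarrow> bool" where
  "Ck_holder_on 0 \<alpha> S f \<longleftrightarrow> (\<forall>K. compact K \<and> K \<subseteq> S \<longrightarrow> holder_on \<alpha> K f)"
| "Ck_holder_on (Suc k) \<alpha> S f \<longleftrightarrow>
     (\<forall>x\<in>S. f differentiable (at x)) \<and> (\<forall>b\<in>Basis. Ck_holder_on k \<alpha> S (partial b f))"

definition extends_continuously ::
  "'a::topological_space set \<Rightarrow> 'a set \<Rightarrow> ('a \<Rightarrow> 'b::topological_space) \<Rightarrow> bool" where
  "extends_continuously S T f \<longleftrightarrow> (\<exists>F. continuous_on T F \<and> (\<forall>x\<in>S. F x = f x))"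

text \<open>
  For open \<open>S\<close> and \<open>S \<subseteq> T \<subseteq> closure S\<close> this is the space \<open>C\<^sup>1(T)\<close>: \<open>f\<close> and its first derivatives
  on \<open>S\<close> extend continuously to \<open>T\<close>. The values of \<open>f\<close> itself outside \<open>S\<close> are irrelevant.
\<close>

definition C1_upto ::
  "'a::euclidean_space set \<Rightarrow> 'a set \<Rightarrow> ('a \<Rightarrow> 'b::real_normed_vector) \<Rightarrow> bool" where
  "C1_upto S T f \<longleftrightarrow>
     (\<forall>x\<in>S. f differentiable (at x)) \<and> extends_continuously S T f \<and>
     (\<forall>b\<in>Basis. extends_continuously S T (partial b f))"


section \<open>Domains\<close>

text \<open>
  Gilbarg and Trudinger, Elliptic Partial Differential Equations of Second Order, Section 6.2:
  near each boundary point a \<open>C\<^sup>k\<^sup>,\<^sup>\<alpha>\<close> diffeomorphism straightens the boundary, mapping the domain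
  into an open half space and its boundary into the bounding hyperplane. Since the image of the
  ball is open, the domain necessarily lies on one side of its boundary.
\<close>

definition Ck_holder_boundary :: "nat \<Rightarrow> real \<Rightarrow> 'a::euclidean_space set \<Rightarrow> bool" where
  "Ck_holder_boundary k \<alpha> \<Omega> \<longleftrightarrow>
     (\<forall>x\<^sub>0\<in>frontier \<Omega>. \<exists>r>0. \<exists>\<psi>::'a \<Rightarrow> 'a. \<exists>e\<in>Basis.
        let B = ball x\<^sub>0 r in
          inj_on \<psi> B \<and> open (\<psi> ` B) \<and>
          \<psi> ` (B \<inter> \<Omega>) \<subseteq> {y. y \<bullet> e > 0} \<and>
          \<psi> ` (B \<inter> frontier \<Omega>) \<subseteq> {y. y \<bullet> e = 0} \<and>
          Ck_holder_on k \<alpha> B \<psi> \<and>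
          Ck_holder_on k \<alpha> (\<psi> ` B) (the_inv_into B \<psi>))"

definition tangent_vectors :: "'a::real_normed_vector set \<Rightarrow> 'a \<Rightarrow> 'a set" where
  "tangent_vectors S x =
     {v. \<exists>\<gamma> \<epsilon>. \<epsilon> > 0 \<and> \<gamma> 0 = x \<and> (\<forall>t\<in>{-\<epsilon><..<\<epsilon>}. \<gamma> t \<in> S) \<and> (\<gamma> has_vector_derivative v) (at 0)}"

text \<open>
  In dimension one the only tangent vector of the boundary is zero, and the last condition
  alone selects the sign of \<open>n\<close>.
\<close>

definition outer_unit_normal :: "'a::euclidean_space set \<Rightarrow> 'a \<Rightarrow> 'a \<Rightarrow> bool" where
  "outer_unit_normal \<Omega> x n \<longleftrightarrow>
     norm n = 1 \<and> (\<forall>v\<in>tangent_vectors (frontier \<Omega>) x. v \<bullet> n = 0) \<and>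
     (\<forall>\<^sub>F t in at_right 0. x - t *\<^sub>R n \<in> \<Omega> \<and> x + t *\<^sub>R n \<notin> closure \<Omega>)"


section \<open>The stationary best reply strategy system\<close>

text \<open>
  The gradient of \<open>z \<mapsto> h(z, m(z))\<close> in the equation and the boundary condition is the total one.
  Since \<open>m\<close> is a function on the open set \<open>\<Omega>\<close>, the boundary values of \<open>\<nabla>m\<close> and of \<open>m \<nabla>[h(x,m)]\<close>
  are those of the continuous extensions, i.e. limits from within \<open>\<Omega>\<close>.
\<close>

definition BRS_equation ::
  "real \<Rightarrow> ('a::euclidean_space \<Rightarrow> real \<Rightarrow> real) \<Rightarrow> 'a set \<Rightarrow> ('a \<Rightarrow> real) \<Rightarrow> bool" where
  "BRS_equation \<sigma> h \<Omega> m \<longleftrightarrow>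
     (\<forall>x\<in>\<Omega>. - (\<sigma>\<^sup>2 / 2) * laplacian m x
            - divergence (\<lambda>y. m y *\<^sub>R grad (\<lambda>z. h z (m z)) y) x = 0)"

definition BRS_boundary ::
  "real \<Rightarrow> ('a::euclidean_space \<Rightarrow> real \<Rightarrow> real) \<Rightarrow> 'a set \<Rightarrow> ('a \<Rightarrow> 'a) \<Rightarrow> ('a \<Rightarrow> real) \<Rightarrow> bool" where
  "BRS_boundary \<sigma> h \<Omega> \<nu> m \<longleftrightarrow>
     (\<forall>x\<in>frontier \<Omega>. \<exists>p q.
        (grad m \<longlongrightarrow> p) (at x within \<Omega>) \<and>
        ((\<lambda>y. m y *\<^sub>R grad (\<lambda>z. h z (m z)) y) \<longlongrightarrow> q) (at x within \<Omega>) \<and>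
        - (\<sigma>\<^sup>2 / 2) * (p \<bullet> \<nu> x) - q \<bullet> \<nu> x = 0)"

end

theory Submission
  imports Defs
begin

text \<open>
  Write \<open>k = \<sigma>\<^sup>2 / 2\<close>. For positive \<open>m\<close> the negative flux factorizes as
  \<open>k \<nabla>m + m \<nabla>[h(x,m)] = m \<nabla>u\<close> with \<open>u(x) = k ln (m(x)) + h(x, m(x))\<close>. So the system says that
  \<open>\<nabla> \<bullet> (m \<nabla>u) = 0\<close> in \<open>\<Omega>\<close> with vanishing flux through the boundary, and the solutions are
  exactly the \<open>m\<close> of mass one for which \<open>u\<close> is constant.

  That \<open>u\<close> is constant for every solution follows from the maximum principle for the equation
  \<open>\<nabla>\<^sup>2u + (\<nabla>m / m) \<bullet> \<nabla>u = 0\<close>: if \<open>u\<close> is not constant, its maximum lies on the boundary, and there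
  Hopf's boundary point lemma contradicts the zero flux (\<open>first_integral_constant\<close>). The smoothness of
  the boundary enters only through the interior sphere condition (\<open>interior_ball_at_boundary\<close>).

  Conversely, since \<open>h(x,\<cdot>)\<close> is nondecreasing, \<open>k ln s + h(x,s) = c\<close> has a unique root
  \<open>s = sol x c > 0\<close> for each \<open>c\<close>, also for the extension of \<open>h\<close> to the closure. By implicit
  differentiation \<open>sol\<close> has in \<open>x\<close> the required regularity (\<open>sol_C1\<close>, \<open>sol_C2\<close>). Its mass is continuous
  and strictly increasing in \<open>c\<close> and takes values on both sides of one, so that exactly one \<open>c\<close> gives
  mass one (\<open>mass_one_exists\<close>, \<open>mass_strict_mono\<close>).
\<close>


section \<open>Calculus of gradients and function spaces\<close>

lemma partial_eqI: "(f has_derivative f') (at x) \<Longrightarrow> partial b f x = f' b"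
  by (metis frechet_derivative_at partial_def)

lemma frechet_derivative_partial:
  fixes f :: "'a::euclidean_space \<Rightarrow> 'b::real_normed_vector"
  assumes "f differentiable (at x)"
  shows "frechet_derivative f (at x) v = (\<Sum>b\<in>Basis. (v \<bullet> b) *\<^sub>R partial b f x)"
proof -
  interpret linear "frechet_derivative f (at x)"
    using assms linear_frechet_derivative by blast
  have "frechet_derivative f (at x) (\<Sum>b\<in>Basis. (v \<bullet> b) *\<^sub>R b) = (\<Sum>b\<in>Basis. (v \<bullet> b) *\<^sub>R partial b f x)"
    unfolding partial_def by (simp add: sum scale)
  then show ?thesis by (simp add: euclidean_representation)
qed

lemma has_derivative_partial:
  fixes f :: "'a::euclidean_space \<Rightarrow> 'b::real_normed_vector"
  assumes "f differentiable (at x)"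
  shows "(f has_derivative (\<lambda>v. \<Sum>b\<in>Basis. (v \<bullet> b) *\<^sub>R partial b f x)) (at x)"
proof -
  have "frechet_derivative f (at x) = (\<lambda>v. \<Sum>b\<in>Basis. (v \<bullet> b) *\<^sub>R partial b f x)"
    using frechet_derivative_partial[OF assms] by (rule ext)
  then show ?thesis using assms frechet_derivative_works by metis
qed

lemma GDERIV_grad:
  assumes "u differentiable (at x)"
  shows "GDERIV u x :> grad u x"
  using has_derivative_partial[OF assms] unfolding gderiv_def grad_def
  by (simp add: inner_sum_right mult.commute)

lemma GDERIV_continuous_on:
  assumes "\<And>x. x \<in> S \<Longrightarrow> GDERIV u x :> U x"
  shows "continuous_on S u"
proof (rule continuous_at_imp_continuous_on, rule ballI)
  fix x assume "x \<in> S"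
  then show "isCont u x"
    by (rule has_derivative_continuous[OF assms[unfolded gderiv_def]])
qed

lemma grad_inner_Basis:
  assumes "b \<in> Basis"
  shows "grad u x \<bullet> b = partial b u x"
proof -
  have "grad u x \<bullet> b = (\<Sum>i\<in>Basis. if i = b then partial i u x else 0)"
    using assms unfolding grad_def inner_sum_left by (intro sum.cong) (auto simp: inner_Basis)
  then show ?thesis using assms by simp
qed

lemma partial_cong_open:
  assumes "open S" "x \<in> S" "\<And>y. y \<in> S \<Longrightarrow> f y = g y"
  shows "partial b f x = partial b g x"
proof -
  have "(f has_derivative D) (at x) \<longleftrightarrow> (g has_derivative D) (at x)" for D
    using has_derivative_transform_within_open[of f D x UNIV S g]
      has_derivative_transform_within_open[of g D x UNIV S f] assms by auto
  then show ?thesis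
    unfolding partial_def frechet_derivative_def by simp
qed

lemma grad_cong_open:
  assumes "open S" "x \<in> S" "\<And>y. y \<in> S \<Longrightarrow> f y = g y"
  shows "grad f x = grad g x"
  using partial_cong_open[OF assms] by (simp add: grad_def)

lemma divergence_cong_open:
  assumes "open S" "x \<in> S" "\<And>y. y \<in> S \<Longrightarrow> f y = g y"
  shows "divergence f x = divergence g x"
  using partial_cong_open[OF assms] by (simp add: divergence_def)

lemma differentiable_cong_open:
  assumes "open S" "x \<in> S" "\<And>y. y \<in> S \<Longrightarrow> f y = g y" "f differentiable (at x)"
  shows "g differentiable (at x)"
proof -
  obtain D where "(f has_derivative D) (at x)"
    using assms(4) unfolding differentiable_def by blast
  then have "(g has_derivative D) (at x)"
    using has_derivative_transform_within_open assms(1-3) by blast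
  then show ?thesis unfolding differentiable_def by blast
qed

lemma Ck_on_cong:
  assumes "open S" "\<And>y. y \<in> S \<Longrightarrow> f y = g y" "Ck_on k S f"
  shows "Ck_on k S g"
  using assms(2,3)
proof (induction k arbitrary: f g)
  case 0
  then show ?case using continuous_on_cong by force
next
  case (Suc k)
  have "g differentiable (at x)" if "x \<in> S" for x
    using differentiable_cong_open[OF assms(1) that Suc.prems(1)] Suc.prems(2) that by auto
  moreover have "Ck_on k S (partial b g)" if "b \<in> Basis" for b
    using Suc.IH[of "partial b f" "partial b g"] Suc.prems that
      partial_cong_open[OF assms(1) _ Suc.prems(1)] by auto
  ultimately show ?case by simp
qed

lemma Ck_on_2:
  "Ck_on 2 S f \<longleftrightarrow> (\<forall>x\<in>S. f differentiable (at x)) \<and> (\<forall>b\<in>Basis. Ck_on 1 S (partial b f))"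
  by (simp add: numeral_2_eq_2)

lemma Ck_on_1:
  "Ck_on 1 S f \<longleftrightarrow> (\<forall>x\<in>S. f differentiable (at x)) \<and> (\<forall>b\<in>Basis. continuous_on S (partial b f))"
  by simp

lemma Ck_on_1_imp_continuous: "Ck_on 1 S f \<Longrightarrow> continuous_on S f"
  by (simp add: continuous_at_imp_continuous_on differentiable_imp_continuous_within)

lemma Ck_on_1_add:
  assumes "Ck_on 1 S f" "Ck_on 1 S g"
  shows "Ck_on 1 S (\<lambda>x. f x + g x)"
proof -
  have *: "((\<lambda>x. f x + g x) has_derivative (\<lambda>v. frechet_derivative f (at x) v + frechet_derivative g (at x) v)) (at x)"
    if "x \<in> S" for x
    using assms that by (intro has_derivative_add) (auto simp: frechet_derivative_works)
  have "continuous_on S (partial b (\<lambda>x. f x + g x))" if "b \<in> Basis" for b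
  proof (rule continuous_on_eq)
    show "continuous_on S (\<lambda>x. partial b f x + partial b g x)"
      using assms that by (auto intro!: continuous_intros)
  qed (use partial_eqI[OF *] in \<open>auto simp: partial_def\<close>)
  with * show ?thesis unfolding Ck_on_1 differentiable_def by blast
qed

lemma Ck_on_1_mult:
  fixes f g :: "'a::euclidean_space \<Rightarrow> real"
  assumes f: "Ck_on 1 S f" and g: "Ck_on 1 S g"
  shows "Ck_on 1 S (\<lambda>x. f x * g x)"
proof -
  have *: "((\<lambda>x. f x * g x) has_derivative
      (\<lambda>v. f x * frechet_derivative g (at x) v + frechet_derivative f (at x) v * g x)) (at x)"
    if "x \<in> S" for x
    using assms that by (intro has_derivative_mult) (auto simp: frechet_derivative_works)
  have "continuous_on S (partial b (\<lambda>x. f x * g x))" if "b \<in> Basis" for b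
  proof (rule continuous_on_eq)
    show "continuous_on S (\<lambda>x. f x * partial b g x + partial b f x * g x)"
      using assms that Ck_on_1_imp_continuous[OF f] Ck_on_1_imp_continuous[OF g]
      by (auto intro!: continuous_intros)
  qed (use partial_eqI[OF *] in \<open>auto simp: partial_def\<close>)
  with * show ?thesis unfolding Ck_on_1 differentiable_def by blast
qed

lemma Ck_on_1_compose:
  fixes g :: "'a::euclidean_space \<Rightarrow> 'b::euclidean_space" and f :: "'b \<Rightarrow> 'c::real_normed_vector"
  assumes f: "Ck_on 1 T f" and g: "Ck_on 1 S g" and ST: "\<And>x. x \<in> S \<Longrightarrow> g x \<in> T"
  shows "Ck_on 1 S (\<lambda>x. f (g x))"
proof -
  have *: "((\<lambda>x. f (g x)) has_derivative
      (\<lambda>v. frechet_derivative f (at (g x)) (frechet_derivative g (at x) v))) (at x)"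
    if "x \<in> S" for x
    using assms that unfolding Ck_on_1 frechet_derivative_works by (blast intro: has_derivative_compose)
  have "continuous_on S (partial b (\<lambda>x. f (g x)))" if "b \<in> Basis" for b
  proof (rule continuous_on_eq)
    show "continuous_on S (\<lambda>x. \<Sum>i\<in>Basis. (partial b g x \<bullet> i) *\<^sub>R partial i f (g x))"
    proof (intro continuous_intros)
      show "continuous_on S (partial b g)" using g that by auto
      fix i :: 'b assume "i \<in> Basis"
      then have "continuous_on T (partial i f)" using f by auto
      then show "continuous_on S (\<lambda>x. partial i f (g x))"
        using continuous_on_compose2[OF _ Ck_on_1_imp_continuous[OF g]] ST by blast
    qed
    fix x assume x: "x \<in> S"
    have "partial b (\<lambda>x. f (g x)) x = frechet_derivative f (at (g x)) (partial b g x)"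
      using partial_eqI[OF *[OF x]] by (simp add: partial_def)
    also have "\<dots> = (\<Sum>i\<in>Basis. (partial b g x \<bullet> i) *\<^sub>R partial i f (g x))"
      using f ST[OF x] by (intro frechet_derivative_partial) auto
    finally show "(\<Sum>i\<in>Basis. (partial b g x \<bullet> i) *\<^sub>R partial i f (g x)) = partial b (\<lambda>x. f (g x)) x" ..
  qed
  with * show ?thesis unfolding Ck_on_1 differentiable_def by blast
qed

lemma Ck_on_1_graph:
  fixes u :: "'a::euclidean_space \<Rightarrow> real"
  assumes u: "Ck_on 1 S u"
  shows "Ck_on 1 S (\<lambda>x. (x, u x))"
proof -
  have *: "((\<lambda>x. (x, u x)) has_derivative (\<lambda>v. (v, frechet_derivative u (at x) v))) (at x)"
    if "x \<in> S" for x
    using assms that by (intro has_derivative_Pair has_derivative_ident) (auto simp: frechet_derivative_works)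
  have "continuous_on S (partial b (\<lambda>x. (x, u x)))" if "b \<in> Basis" for b
  proof (rule continuous_on_eq)
    show "continuous_on S (\<lambda>x. (b, partial b u x))"
      using assms that by (auto intro!: continuous_intros)
  qed (use partial_eqI[OF *] in \<open>auto simp: partial_def\<close>)
  with * show ?thesis unfolding Ck_on_1 differentiable_def by blast
qed

lemma Ck_on_1_real:
  fixes f :: "real \<Rightarrow> real"
  assumes "\<And>x. x \<in> S \<Longrightarrow> (f has_real_derivative f' x) (at x)" "continuous_on S f'"
  shows "Ck_on 1 S f"
proof -
  have *: "(f has_derivative (\<lambda>v. f' x * v)) (at x)" if "x \<in> S" for x
    using assms(1)[OF that] by (simp add: has_field_derivative_def)
  have "continuous_on S (partial 1 f)"
    by (rule continuous_on_eq[OF assms(2)]) (use partial_eqI[OF *] in auto)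
  with * show ?thesis unfolding Ck_on_1 differentiable_def by auto
qed

lemma Ck_on_2_imp_1:
  assumes "Ck_on 2 S f"
  shows "Ck_on 1 S f"
  using assms Ck_on_1_imp_continuous unfolding Ck_on_2 Ck_on_1[of S f] by blast

lemma Ck_on_1_compose_graph:
  fixes u :: "'a::euclidean_space \<Rightarrow> real" and f :: "'a \<times> real \<Rightarrow> 'b::real_normed_vector"
  assumes "Ck_on 1 T f" "Ck_on 1 S u" "\<And>x. x \<in> S \<Longrightarrow> (x, u x) \<in> T"
  shows "Ck_on 1 S (\<lambda>x. f (x, u x))"
  using Ck_on_1_compose[OF assms(1) Ck_on_1_graph[OF assms(2)] assms(3)] .

lemma partial_graph:
  fixes u :: "'a::euclidean_space \<Rightarrow> real" and f :: "'a \<times> real \<Rightarrow> real"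
  assumes "f differentiable (at (x, u x))" "u differentiable (at x)"
  shows "((\<lambda>x. f (x, u x)) has_derivative (\<lambda>v. frechet_derivative f (at (x, u x)) (v, frechet_derivative u (at x) v))) (at x)"
    and "partial b (\<lambda>x. f (x, u x)) x = partial (b, 0) f (x, u x) + partial (0, 1) f (x, u x) * partial b u x"
proof -
  let ?D = "frechet_derivative f (at (x, u x))"
  have "((\<lambda>x. (x, u x)) has_derivative (\<lambda>v. (v, frechet_derivative u (at x) v))) (at x)"
    using assms(2) by (intro has_derivative_Pair has_derivative_ident) (auto simp: frechet_derivative_works)
  then show *: "((\<lambda>x. f (x, u x)) has_derivative (\<lambda>v. ?D (v, frechet_derivative u (at x) v))) (at x)"
    by (rule has_derivative_compose) (use assms(1) in \<open>simp add: frechet_derivative_works\<close>)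
  interpret linear ?D
    using assms(1) linear_frechet_derivative by blast
  have "partial b (\<lambda>x. f (x, u x)) x = ?D ((b, 0) + partial b u x *\<^sub>R (0, 1))"
    using partial_eqI[OF *] by (simp add: partial_def)
  then show "partial b (\<lambda>x. f (x, u x)) x = partial (b, 0) f (x, u x) + partial (0, 1) f (x, u x) * partial b u x"
    unfolding add scale by (simp add: partial_def)
qed

lemma Ck_on_2_graph:
  fixes u :: "'a::euclidean_space \<Rightarrow> real" and f :: "'a \<times> real \<Rightarrow> real"
  assumes f: "Ck_on 2 T f" and u: "Ck_on 2 S u" and ST: "\<And>x. x \<in> S \<Longrightarrow> (x, u x) \<in> T" and "open S"
  shows "Ck_on 2 S (\<lambda>x. f (x, u x))"
proof -
  have df: "f differentiable (at (x, u x))" "u differentiable (at x)" if "x \<in> S" for x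
    using that f u ST unfolding Ck_on_2 by auto
  have "Ck_on 1 S (partial b (\<lambda>x. f (x, u x)))" if b: "b \<in> Basis" for b
  proof (rule Ck_on_cong[OF \<open>open S\<close>])
    have "(b, 0) \<in> Basis" "(0, 1::real) \<in> (Basis :: ('a \<times> real) set)"
      using b by (auto simp: Basis_prod_def)
    then have "Ck_on 1 T (partial (b, 0) f)" "Ck_on 1 T (partial (0, 1) f)"
      using f unfolding Ck_on_2 by auto
    then have "Ck_on 1 S (\<lambda>x. partial (b, 0) f (x, u x))" "Ck_on 1 S (\<lambda>x. partial (0, 1) f (x, u x))"
      using Ck_on_1_compose_graph[OF _ Ck_on_2_imp_1[OF u] ST] by blast+
    moreover have "Ck_on 1 S (partial b u)"
      using u b unfolding Ck_on_2 by blast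
    ultimately show "Ck_on 1 S (\<lambda>x. partial (b, 0) f (x, u x) + partial (0, 1) f (x, u x) * partial b u x)"
      by (intro Ck_on_1_add Ck_on_1_mult) blast+
  qed (use partial_graph(2)[OF df] in simp)
  then show ?thesis
    using partial_graph(1)[OF df] unfolding Ck_on_2 differentiable_def by blast
qed

lemma grad_differentiable:
  assumes "Ck_on 2 S u" "x \<in> S"
  shows "grad u differentiable (at x)"
proof -
  have "(\<lambda>x. \<Sum>b\<in>Basis. partial b u x *\<^sub>R b) differentiable (at x)"
    using assms unfolding Ck_on_2 Ck_on_1 by (intro differentiable_sum differentiable_scaleR) auto
  then show ?thesis by (simp add: grad_def [abs_def])
qed

lemma continuous_on_grad:
  assumes "Ck_on 1 S u"
  shows "continuous_on S (grad u)"
  unfolding grad_def [abs_def] using assms by (intro continuous_intros) auto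

lemma partial_inner:
  assumes "F differentiable (at x)"
  shows "partial b (\<lambda>y. F y \<bullet> c) x = partial b F x \<bullet> c"
  using assms by (intro partial_eqI[of _ "\<lambda>b. partial b F x \<bullet> c"])
    (auto intro!: has_derivative_inner_left simp: partial_def frechet_derivative_works)

lemma divergence_grad:
  assumes "grad u differentiable (at x)"
  shows "divergence (grad u) x = laplacian u x"
  unfolding divergence_def laplacian_def
proof (intro sum.cong refl)
  fix b :: 'a assume b: "b \<in> Basis"
  have "partial b (grad u) x \<bullet> b = partial b (\<lambda>y. grad u y \<bullet> b) x"
    using partial_inner[OF assms] ..
  then show "partial b (grad u) x \<bullet> b = partial b (partial b u) x"
    using grad_inner_Basis[OF b] by simp
qed

lemma divergence_scaleR_add:
  assumes "F differentiable (at x)" "G differentiable (at x)"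
  shows "divergence (\<lambda>y. c *\<^sub>R F y + G y) x = c * divergence F x + divergence G x"
proof -
  have "((\<lambda>y. c *\<^sub>R F y + G y) has_derivative (\<lambda>b. c *\<^sub>R partial b F x + partial b G x)) (at x)"
    using assms unfolding partial_def frechet_derivative_works[symmetric]
    by (intro derivative_intros) (auto simp: frechet_derivative_works)
  from partial_eqI[OF this] show ?thesis
    by (simp add: divergence_def inner_add_left sum.distrib sum_distrib_left)
qed

lemma divergence_scaleR:
  assumes "m differentiable (at x)" "U differentiable (at x)"
  shows "divergence (\<lambda>y. m y *\<^sub>R U y) x = grad m x \<bullet> U x + m x * divergence U x"
proof -
  have "((\<lambda>y. m y *\<^sub>R U y) has_derivative (\<lambda>b. m x *\<^sub>R partial b U x + partial b m x *\<^sub>R U x)) (at x)"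
    using assms unfolding partial_def frechet_derivative_works
    by (rule has_derivative_scaleR)
  from partial_eqI[OF this] show ?thesis
    by (simp add: divergence_def grad_def inner_add_left inner_sum_left sum.distrib sum_distrib_left
        inner_commute[of "U x"])
qed

lemma C1_upto_cong:
  assumes "open S" "\<And>x. x \<in> S \<Longrightarrow> f x = g x" "C1_upto S T f"
  shows "C1_upto S T g"
  using assms(3) differentiable_cong_open[OF assms(1) _ assms(2)] partial_cong_open[OF assms(1) _ assms(2)]
    assms(2) unfolding C1_upto_def extends_continuously_def by (simp cong: ball_cong)

lemma C1_upto_grad_limit:
  fixes m :: "'a::euclidean_space \<Rightarrow> real"
  assumes "C1_upto S T m" "S \<subseteq> T" "x \<in> T"
  shows "\<exists>p. (grad m \<longlongrightarrow> p) (at x within S)"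
proof -
  have "\<exists>l. (partial b m \<longlongrightarrow> l) (at x within S)" if "b \<in> Basis" for b
  proof -
    obtain P where P: "continuous_on T P" "\<forall>x\<in>S. P x = partial b m x"
      using assms(1) \<open>b \<in> Basis\<close> unfolding C1_upto_def extends_continuously_def by blast
    then have "(P \<longlongrightarrow> P x) (at x within S)"
      using assms(2,3) unfolding continuous_on_def by (blast intro: tendsto_within_subset)
    then have "(partial b m \<longlongrightarrow> P x) (at x within S)"
      by (rule Lim_transform_eventually) (use P(2) in \<open>simp add: eventually_at_filter\<close>)
    then show ?thesis by blast
  qed
  then obtain l where "\<And>b. b \<in> Basis \<Longrightarrow> (partial b m \<longlongrightarrow> l b) (at x within S)"
    by metis
  then have "((\<lambda>x. \<Sum>b\<in>Basis. partial b m x *\<^sub>R b) \<longlongrightarrow> (\<Sum>b\<in>Basis. l b *\<^sub>R b)) (at x within S)"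
    by (intro tendsto_sum tendsto_scaleR tendsto_const)
  then show ?thesis unfolding grad_def [abs_def] by blast
qed


section \<open>Hopf's lemma and the strong maximum principle\<close>

lemma local_max_derivatives:
  fixes f f' :: "real \<Rightarrow> real"
  assumes "e > 0" and f: "\<And>t. \<bar>t\<bar> < e \<Longrightarrow> (f has_real_derivative f' t) (at t)"
    and f': "(f' has_real_derivative l) (at 0)"
    and max: "\<And>t. \<bar>t\<bar> < e \<Longrightarrow> f t \<le> f 0"
  shows "f' 0 = 0" "l \<le> 0"
proof -
  show 0: "f' 0 = 0"
    using DERIV_local_max[OF f[of 0] \<open>e > 0\<close>] max \<open>e > 0\<close> by simp
  show "l \<le> 0"
  proof (rule ccontr)
    assume "\<not> l \<le> 0"
    then obtain d where d: "d > 0" "\<And>t. 0 < t \<Longrightarrow> t < d \<Longrightarrow> 0 < f' t"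
      using DERIV_pos_inc_right[OF f'] 0 by auto
    define t where "t = min d e / 2"
    have t: "0 < t" "t < d" "t < e" using d(1) \<open>e > 0\<close> by (auto simp: t_def)
    obtain s where s: "0 < s" "s < t" "f t - f 0 = (t - 0) * f' s"
      using MVT2[OF t(1), of f f'] f t by auto
    then show False
      using max[of t] d(2)[of s] t by (smt (verit) mult_pos_pos)
  qed
qed

text \<open>
  The necessary conditions at an interior maximum, for a function with gradient \<open>W\<close> whose
  derivative at the maximum is \<open>W'\<close>, so that \<open>W' b \<bullet> b\<close> is the second derivative in the direction \<open>b\<close>.
\<close>

lemma interior_max_derivatives:
  fixes w :: "'a::euclidean_space \<Rightarrow> real"
  assumes "open S" "z \<in> S" and w: "\<And>x. x \<in> S \<Longrightarrow> GDERIV w x :> W x"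
    and W: "(W has_derivative W') (at z)" and max: "\<And>x. x \<in> S \<Longrightarrow> w x \<le> w z"
  shows "W z = 0" "W' b \<bullet> b \<le> 0"
proof -
  have *: "W z \<bullet> b = 0 \<and> W' b \<bullet> b \<le> 0" for b
  proof -
    obtain e where e: "e > 0" "ball z e \<subseteq> S"
      using assms(1,2) openE by blast
    define e' where "e' = e / (norm b + 1)"
    have e': "e' > 0" using e by (simp add: e'_def add_nonneg_pos)
    have S: "z + t *\<^sub>R b \<in> S" if "\<bar>t\<bar> < e'" for t
    proof -
      have "\<bar>t\<bar> * norm b \<le> \<bar>t\<bar> * (norm b + 1)" by (simp add: mult_left_mono)
      also have "\<dots> < e" using that by (simp add: e'_def pos_less_divide_eq add_nonneg_pos)
      finally show ?thesis using e(2) by (auto simp: dist_norm)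
    qed
    have line: "((\<lambda>t. z + t *\<^sub>R b) has_derivative (\<lambda>t. t *\<^sub>R b)) (at t)" for t
      by (auto intro!: derivative_eq_intros)
    have d1: "((\<lambda>t. w (z + t *\<^sub>R b)) has_real_derivative W (z + t *\<^sub>R b) \<bullet> b) (at t)"
      if "\<bar>t\<bar> < e'" for t
      by (rule has_derivative_imp_has_field_derivative
          [OF has_derivative_compose[OF line w[OF S[OF that], unfolded gderiv_def]]])
        (simp add: inner_commute)
    have lin: "W' (t *\<^sub>R b) = t *\<^sub>R W' b" for t
      using W has_derivative_linear linear_scale by blast
    have "((\<lambda>t. W (z + t *\<^sub>R b)) has_derivative (\<lambda>t. W' (t *\<^sub>R b))) (at 0)"
      using has_derivative_compose[OF line[of 0], of W W'] W by simp
    from has_derivative_inner_left[OF this, of b]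
    have d2: "((\<lambda>t. W (z + t *\<^sub>R b) \<bullet> b) has_real_derivative W' b \<bullet> b) (at 0)"
      by (rule has_derivative_imp_has_field_derivative) (simp add: lin)
    show ?thesis
      using local_max_derivatives[OF e' d1 d2] max[OF S] by simp
  qed
  from *[of "W z"] show "W z = 0" by simp
  from * show "W' b \<bullet> b \<le> 0" by blast
qed

text \<open>
  A solution \<open>u < M\<close> of \<open>\<nabla>\<^sup>2u + \<beta> \<bullet> \<nabla>u = 0\<close> in an open ball, with \<open>U\<close> the gradient of \<open>u\<close>,
  \<open>U'\<close> the derivative of \<open>U\<close>, and a bounded drift \<open>\<beta>\<close>. Nothing is assumed on the boundary of the ball.
\<close>

locale elliptic_ball =
  fixes u :: "'a::euclidean_space \<Rightarrow> real" and U :: "'a \<Rightarrow> 'a" and U' :: "'a \<Rightarrow> 'a \<Rightarrow> 'a"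
    and \<beta> :: "'a \<Rightarrow> 'a" and K M R :: real and y :: 'a
  assumes R: "R > 0"
    and u: "\<And>x. x \<in> ball y R \<Longrightarrow> GDERIV u x :> U x"
    and U: "\<And>x. x \<in> ball y R \<Longrightarrow> (U has_derivative U' x) (at x)"
    and eq: "\<And>x. x \<in> ball y R \<Longrightarrow> (\<Sum>b\<in>Basis. U' x b \<bullet> b) + \<beta> x \<bullet> U x = 0"
    and bound: "\<And>x. x \<in> ball y R \<Longrightarrow> norm (\<beta> x) \<le> K"
    and less: "\<And>x. x \<in> ball y R \<Longrightarrow> u x < M"
begin

lemma cont: "continuous_on (ball y R) u"
  by (rule GDERIV_continuous_on[OF u])

text \<open>
  Hopf's barrier argument: \<open>u\<close> stays below \<open>M\<close> by a multiple of the distance to the sphere. The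
  barrier is \<open>\<epsilon> (exp (-a \<bar>x - y\<bar>\<^sup>2) - exp (-a R\<^sup>2))\<close>, a strict subsolution in the annulus between the
  radii \<open>R / 2\<close> and \<open>R\<close> for large \<open>a\<close>.
\<close>

lemma hopf_bound:
  obtains c where "c > 0"
    "\<And>x. x \<in> ball y R \<Longrightarrow> R / 2 \<le> norm (x - y) \<Longrightarrow> u x \<le> M - c * (R - norm (x - y))"
proof -
  define d where "d = real DIM('a)"
  have K: "K \<ge> 0" using bound[of y] R norm_ge_zero order_trans centre_in_ball by blast
  define a where "a = (2 * d + 2 * K * R + 1) / R\<^sup>2"
  have aR: "a * R\<^sup>2 = 2 * d + 2 * K * R + 1" using R by (simp add: a_def)
  have a: "a > 0" using R K by (simp add: a_def d_def add_nonneg_pos)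
  define E where "E x = exp (- a * ((x - y) \<bullet> (x - y)))" for x
  define V where "V x = (- 2 * a * E x) *\<^sub>R (x - y)" for x
  define V' where "V' x k = (- 2 * a * E x) *\<^sub>R k + (4 * a\<^sup>2 * E x * ((x - y) \<bullet> k)) *\<^sub>R (x - y)" for x k
  have E: "GDERIV E x :> V x" for x
    unfolding gderiv_def E_def V_def
    by (auto intro!: derivative_eq_intros ext simp: inner_commute algebra_simps)
  have V: "(V has_derivative V' x) (at x)" for x
    unfolding V_def V'_def
    by (auto intro!: derivative_eq_intros ext E[unfolded gderiv_def] simp: V_def inner_commute algebra_simps power2_eq_square)
  have LV: "(\<Sum>b\<in>Basis. V' x b \<bullet> b) + \<beta> x \<bullet> V x > 0"
    if x: "x \<in> ball y R" "R / 2 \<le> norm (x - y)" for x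
  proof -
    have "(\<Sum>b\<in>Basis. V' x b \<bullet> b) = (\<Sum>b\<in>Basis. - 2 * a * E x + 4 * a\<^sup>2 * E x * (((x - y) \<bullet> b) * ((x - y) \<bullet> b)))"
      by (intro sum.cong) (auto simp: V'_def inner_add_left inner_diff_left)
    also have "\<dots> = - 2 * a * E x * d + 4 * a\<^sup>2 * E x * (\<Sum>b\<in>Basis. ((x - y) \<bullet> b) * ((x - y) \<bullet> b))"
      by (simp only: sum.distrib sum_distrib_left[symmetric]) (simp add: d_def)
    also have "\<dots> = E x * a * (4 * a * ((x - y) \<bullet> (x - y)) - 2 * d)"
      by (subst euclidean_inner[of "x - y" "x - y"]) (simp add: algebra_simps power2_eq_square)
    finally have "(\<Sum>b\<in>Basis. V' x b \<bullet> b) + \<beta> x \<bullet> V x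
        = E x * a * (4 * a * (norm (x - y))\<^sup>2 - 2 * d - 2 * (\<beta> x \<bullet> (x - y)))"
      by (simp add: V_def algebra_simps power2_norm_eq_inner)
    moreover have "\<beta> x \<bullet> (x - y) \<le> K * R"
      using norm_cauchy_schwarz[of "\<beta> x" "x - y"] x
        mult_mono[OF bound[OF x(1)], of "norm (x - y)" R] K by (simp add: dist_norm norm_minus_commute)
    moreover have "a * R\<^sup>2 \<le> 4 * a * (norm (x - y))\<^sup>2"
      using power_mono[OF x(2), of 2] R a by (simp add: power_divide)
    ultimately show ?thesis
      using aR a by (simp add: E_def)
  qed
  have "continuous_on (cball y (R / 2)) u"
    using R by (intro continuous_on_subset[OF cont]) auto
  then have "\<exists>p\<in>cball y (R / 2). \<forall>x\<in>cball y (R / 2). u x \<le> u p"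
    using R by (intro continuous_attains_sup) auto
  then obtain p where p: "p \<in> cball y (R / 2)" "\<And>x. x \<in> cball y (R / 2) \<Longrightarrow> u x \<le> u p"
    by blast
  define \<epsilon> where "\<epsilon> = M - u p"
  have \<epsilon>: "\<epsilon> > 0" using less[of p] p(1) R by (simp add: \<epsilon>_def)
  define E\<^sub>R where "E\<^sub>R = exp (- a * R\<^sup>2)"
  define w where "w x = u x + \<epsilon> * (E x - E\<^sub>R)" for x
  have E_norm: "E x = exp (- a * (norm (x - y))\<^sup>2)" for x
    by (simp add: E_def power2_norm_eq_inner)
  have wM: "w x \<le> M" if x: "x \<in> ball y R" "R / 2 \<le> norm (x - y)" for x
  proof (rule ccontr)
    assume "\<not> w x \<le> M"
    then have x1: "w x > M" by simp
    \<comment> \<open>Since \<open>u\<close> has no boundary values, the annulus is shrunk to an outer radius \<open>\<rho>\<close> at which the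
      barrier is too small for \<open>w\<close> to reach \<open>w x\<close>.\<close>
    have "((\<lambda>\<rho>. \<epsilon> * (exp (- a * \<rho>\<^sup>2) - E\<^sub>R)) \<longlongrightarrow> \<epsilon> * (exp (- a * R\<^sup>2) - E\<^sub>R)) (at_left R)"
      by (intro tendsto_intros)
    then have "\<forall>\<^sub>F \<rho> in at_left R. \<epsilon> * (exp (- a * \<rho>\<^sup>2) - E\<^sub>R) < w x - M"
      using x1 by (intro order_tendstoD(2)[of _ "\<epsilon> * (exp (- a * R\<^sup>2) - E\<^sub>R)"]) (auto simp: E\<^sub>R_def)
    moreover have "\<forall>\<^sub>F \<rho> in at_left R. \<rho> \<in> {norm (x - y)<..<R}"
      using x by (intro eventually_at_leftI) (auto simp: dist_norm norm_minus_commute)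
    ultimately have "\<forall>\<^sub>F \<rho> in at_left R. \<epsilon> * (exp (- a * \<rho>\<^sup>2) - E\<^sub>R) < w x - M \<and> \<rho> \<in> {norm (x - y)<..<R}"
      by (rule eventually_conj)
    then obtain \<rho> where \<rho>: "\<epsilon> * (exp (- a * \<rho>\<^sup>2) - E\<^sub>R) < w x - M" "norm (x - y) < \<rho>" "\<rho> < R"
      using eventually_happens[of _ "at_left R"] by (auto simp: trivial_limit_at_left_real)
    define A where "A = cball y \<rho> - ball y (R / 2)"
    have A: "x \<in> A" "compact A" "A \<subseteq> ball y R"
      using x \<rho> by (auto simp: A_def dist_norm norm_minus_commute intro: compact_diff)
    have "continuous_on A w"
      unfolding w_def E_def by (intro continuous_intros continuous_on_subset[OF cont A(3)])
    then obtain z where z: "z \<in> A" "\<And>v. v \<in> A \<Longrightarrow> w v \<le> w z"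
      using continuous_attains_sup[OF A(2)] A(1) by blast
    have wz: "w z > M" "w z \<ge> w x" using z(2)[OF A(1)] x1 by auto
    have zR: "z \<in> ball y R" using z A by blast
    have "norm (z - y) \<noteq> R / 2"
    proof
      assume r: "norm (z - y) = R / 2"
      have "E z \<le> 1" using a by (simp add: E_def)
      moreover have "E\<^sub>R > 0" by (simp add: E\<^sub>R_def)
      ultimately have "E z - E\<^sub>R \<le> 1" by linarith
      then have "\<epsilon> * (E z - E\<^sub>R) \<le> \<epsilon> * 1" using \<epsilon> by (intro mult_left_mono) auto
      moreover have "u z \<le> u p" using p(2)[of z] r by (simp add: dist_norm norm_minus_commute)
      ultimately show False using wz by (simp add: w_def \<epsilon>_def)
    qed
    moreover have "norm (z - y) \<noteq> \<rho>"
      using wz \<rho>(1) less[OF zR] by (auto simp: w_def E_norm)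
    ultimately have zS: "z \<in> ball y \<rho> - cball y (R / 2)"
      using z(1) by (auto simp: A_def dist_norm norm_minus_commute)
    define W where "W v = U v + \<epsilon> *\<^sub>R V v" for v
    have dw: "GDERIV w v :> W v" if "v \<in> ball y R" for v
      unfolding gderiv_def w_def W_def
      by (rule derivative_eq_intros u[OF that, unfolded gderiv_def] E[unfolded gderiv_def] refl)+
        (simp add: inner_add_right)
    have dW: "(W has_derivative (\<lambda>k. U' z k + \<epsilon> *\<^sub>R V' z k)) (at z)"
      unfolding W_def by (intro derivative_intros U[OF zR] V)
    have S: "ball y \<rho> - cball y (R / 2) \<subseteq> A" by (auto simp: A_def)
    have "W z = 0" and tr: "(U' z b + \<epsilon> *\<^sub>R V' z b) \<bullet> b \<le> 0" for b
      using interior_max_derivatives[of "ball y \<rho> - cball y (R / 2)" z w W, OF _ zS dw dW] z(2) S A(3)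
      by blast+
    have "(\<Sum>b\<in>Basis. (U' z b + \<epsilon> *\<^sub>R V' z b) \<bullet> b) \<le> 0"
      by (intro sum_nonpos tr)
    moreover have "(\<Sum>b\<in>Basis. (U' z b + \<epsilon> *\<^sub>R V' z b) \<bullet> b) + \<beta> z \<bullet> W z
        = \<epsilon> * ((\<Sum>b\<in>Basis. V' z b \<bullet> b) + \<beta> z \<bullet> V z)"
      using eq[OF zR] by (simp add: W_def inner_add_left inner_add_right sum.distrib sum_distrib_left algebra_simps)
    moreover have "\<epsilon> * ((\<Sum>b\<in>Basis. V' z b \<bullet> b) + \<beta> z \<bullet> V z) > 0"
      using LV[OF zR] \<epsilon> z(1) by (simp add: A_def dist_norm norm_minus_commute)
    ultimately show False using \<open>W z = 0\<close> by simp
  qed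
  show thesis
  proof
    show "\<epsilon> * (E\<^sub>R * (a * R)) > 0" using \<epsilon> a R by (simp add: E\<^sub>R_def)
    fix x assume x: "x \<in> ball y R" "R / 2 \<le> norm (x - y)"
    let ?r = "norm (x - y)"
    have r: "?r < R" using x by (simp add: dist_norm norm_minus_commute)
    have "a * R * (R - ?r) \<le> a * (R + ?r) * (R - ?r)"
      using a r by (intro mult_right_mono mult_left_mono) auto
    also have "\<dots> = a * R\<^sup>2 - a * ?r\<^sup>2" by (simp add: algebra_simps power2_eq_square)
    also have "\<dots> \<le> exp (a * R\<^sup>2 - a * ?r\<^sup>2) - 1"
      using exp_ge_add_one_self[of "a * R\<^sup>2 - a * ?r\<^sup>2"] by linarith
    finally have "E\<^sub>R * (a * R * (R - ?r)) \<le> E\<^sub>R * (exp (a * R\<^sup>2 - a * ?r\<^sup>2) - 1)"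
      by (intro mult_left_mono) (auto simp: E\<^sub>R_def)
    also have "\<dots> = E x - E\<^sub>R"
      by (simp add: E\<^sub>R_def E_norm algebra_simps flip: exp_add)
    finally have "\<epsilon> * (E\<^sub>R * (a * R * (R - ?r))) \<le> \<epsilon> * (E x - E\<^sub>R)"
      using \<epsilon> by (intro mult_left_mono) auto
    then show "u x \<le> M - \<epsilon> * (E\<^sub>R * (a * R)) * (R - ?r)"
      using wM[OF x] by (simp add: w_def mult.assoc)
  qed
qed

text \<open>
  Hopf's boundary point lemma: the limit of \<open>u\<close> at a point of the sphere cannot be \<open>M\<close> while the
  radial derivative tends to zero there.
\<close>

lemma hopf_contradiction:
  assumes x0: "dist y x0 = R"
    and lim: "(u \<longlongrightarrow> M) (at x0 within ball y R)"
    and normal: "((\<lambda>x. U x \<bullet> (y - x0)) \<longlongrightarrow> 0) (at x0 within ball y R)"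
  shows False
proof -
  obtain c where c: "c > 0"
    "\<And>x. x \<in> ball y R \<Longrightarrow> R / 2 \<le> norm (x - y) \<Longrightarrow> u x \<le> M - c * (R - norm (x - y))"
    using hopf_bound by blast
  define \<gamma> where "\<gamma> t = x0 + t *\<^sub>R (y - x0)" for t :: real
  have "\<gamma> t - y = (t - 1) *\<^sub>R (y - x0)" for t
    by (simp add: \<gamma>_def algebra_simps)
  then have norm_\<gamma>: "norm (\<gamma> t - y) = \<bar>t - 1\<bar> * R" for t
    using x0 by (simp add: dist_norm)
  have ball: "\<gamma> t \<in> ball y R" if "0 < t" "t \<le> 1" for t
    using norm_\<gamma>[of t] that R by (simp add: dist_norm norm_minus_commute)
  have "\<gamma> t \<noteq> x0" if "0 < t" for t
    using that x0 R by (auto simp: \<gamma>_def)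
  moreover have "\<forall>\<^sub>F t in at_right 0. t \<in> {0<..<1::real}"
    by (rule eventually_at_rightI[of _ 1]) auto
  ultimately have ev: "\<forall>\<^sub>F t in at_right 0. \<gamma> t \<in> ball y R \<and> \<gamma> t \<noteq> x0"
    using ball by (auto elim!: eventually_mono simp del: mem_ball)
  have "(\<gamma> \<longlongrightarrow> x0 + 0 *\<^sub>R (y - x0)) (at_right 0)"
    unfolding \<gamma>_def by (intro tendsto_intros)
  then have \<gamma>: "filterlim \<gamma> (at x0 within ball y R) (at_right 0)"
    using ev by (simp add: filterlim_at)
  define C where "C = c * R / 2"
  have C: "C > 0" using c R by (simp add: C_def)
  have "\<forall>\<^sub>F t in at_right 0. \<bar>U (\<gamma> t) \<bullet> (y - x0)\<bar> < C"
    using tendstoD[OF filterlim_compose[OF normal \<gamma>] C] by simp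
  then obtain \<tau> where \<tau>: "\<tau> > 0" "\<And>t. 0 < t \<Longrightarrow> t < \<tau> \<Longrightarrow> \<bar>U (\<gamma> t) \<bullet> (y - x0)\<bar> < C"
    unfolding eventually_at_right_field by auto
  have d: "((\<lambda>t. u (\<gamma> t)) has_real_derivative U (\<gamma> t) \<bullet> (y - x0)) (at t)"
    if "0 < t" "t \<le> 1" for t
  proof -
    have "(\<gamma> has_derivative (\<lambda>t. t *\<^sub>R (y - x0))) (at t)"
      unfolding \<gamma>_def by (auto intro!: derivative_eq_intros)
    from has_derivative_compose[OF this u[OF ball[OF that], unfolded gderiv_def]]
    show ?thesis
      by (rule has_derivative_imp_has_field_derivative) (simp add: inner_commute)
  qed
  define t where "t = min \<tau> 1 / 2"
  have t: "0 < t" "t < \<tau>" "t \<le> 1 / 2" using \<tau> by (auto simp: t_def)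
  have "u (\<gamma> s) - C * t \<le> u (\<gamma> t)" if s: "0 < s" "s < t" for s
  proof -
    obtain r where r: "s < r" "r < t" "u (\<gamma> t) - u (\<gamma> s) = (t - s) * (U (\<gamma> r) \<bullet> (y - x0))"
      using MVT2[OF s(2), of "\<lambda>t. u (\<gamma> t)" "\<lambda>r. U (\<gamma> r) \<bullet> (y - x0)"] d s t by auto
    have "(t - s) * (- C) \<le> (t - s) * (U (\<gamma> r) \<bullet> (y - x0))"
      using \<tau>(2)[of r] r s t by (intro mult_left_mono) auto
    moreover have "(t - s) * C \<le> t * C" using s C by (intro mult_right_mono) auto
    ultimately show ?thesis using r(3) by (simp add: algebra_simps)
  qed
  then have "\<forall>\<^sub>F s in at_right 0. u (\<gamma> s) - C * t \<le> u (\<gamma> t)"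
    using t by (intro eventually_at_rightI[of _ t]) auto
  moreover have "((\<lambda>s. u (\<gamma> s) - C * t) \<longlongrightarrow> M - C * t) (at_right 0)"
    by (intro tendsto_intros filterlim_compose[OF lim \<gamma>])
  ultimately have "M - C * t \<le> u (\<gamma> t)"
    by (intro tendsto_upperbound[of _ _ "at_right 0"]) auto
  moreover have "u (\<gamma> t) \<le> M - c * (R - norm (\<gamma> t - y))"
    using t R by (intro c(2) ball) (auto simp: norm_\<gamma>)
  moreover have "R - norm (\<gamma> t - y) = t * R"
    using t by (simp add: norm_\<gamma> algebra_simps)
  ultimately have "2 * C * t \<le> C * t"
    by (simp add: C_def algebra_simps)
  then show False using C t by simp
qed

end

text \<open>
  The strong maximum principle for a continuous drift. If \<open>u\<close> were not constant, some ball in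
  \<open>{u < M}\<close> would touch \<open>{u = M}\<close> at a point of the domain, where the gradient vanishes.
\<close>

lemma strong_maximum_principle:
  fixes u :: "'a::euclidean_space \<Rightarrow> real"
  assumes "open \<Omega>" "connected \<Omega>"
    and du: "\<And>x. x \<in> \<Omega> \<Longrightarrow> GDERIV u x :> U x"
    and dU: "\<And>x. x \<in> \<Omega> \<Longrightarrow> (U has_derivative U' x) (at x)"
    and eq: "\<And>x. x \<in> \<Omega> \<Longrightarrow> (\<Sum>b\<in>Basis. U' x b \<bullet> b) + \<beta> x \<bullet> U x = 0"
    and \<beta>: "continuous_on \<Omega> \<beta>"
    and le: "\<And>x. x \<in> \<Omega> \<Longrightarrow> u x \<le> M" and max: "p\<^sub>0 \<in> \<Omega>" "u p\<^sub>0 = M" and "q \<in> \<Omega>"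
  shows "u q = M"
proof (rule ccontr)
  assume "u q \<noteq> M"
  have cont: "continuous_on \<Omega> u"
    by (rule GDERIV_continuous_on[OF du])
  define S where "S = {x \<in> \<Omega>. u x = M}"
  have "open (\<Omega> \<inter> u -` {..<M})"
    by (rule continuous_open_preimage[OF cont \<open>open \<Omega>\<close> open_lessThan])
  moreover have "\<Omega> \<inter> u -` {..<M} = \<Omega> - S" using le by (force simp: S_def)
  ultimately have "open (\<Omega> - S)" by simp
  have "\<not> open S"
  proof
    assume "open S"
    then have "\<Omega> \<inter> S = {} \<or> \<Omega> \<inter> (\<Omega> - S) = {}"
      using connectedD[OF \<open>connected \<Omega>\<close> \<open>open S\<close> \<open>open (\<Omega> - S)\<close>] by (auto simp: S_def)
    then show False using max \<open>q \<in> \<Omega>\<close> \<open>u q \<noteq> M\<close> by (auto simp: S_def)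
  qed
  then obtain p where p: "p \<in> S" "\<And>e. e > 0 \<Longrightarrow> \<not> ball p e \<subseteq> S"
    unfolding open_contains_ball by blast
  obtain e where e: "e > 0" "cball p e \<subseteq> \<Omega>"
    using \<open>open \<Omega>\<close> p(1) open_contains_cball by (force simp: S_def)
  define C where "C = {x \<in> cball p e. u x = M}"
  have CS: "C \<subseteq> S" "p \<in> C" using e p by (auto simp: C_def S_def)
  have "closed C"
    unfolding C_def using continuous_closed_preimage_constant[OF continuous_on_subset[OF cont e(2)]] by simp
  obtain y where y: "y \<in> ball p (e / 2)" "y \<notin> S"
    using p(2)[of "e / 2"] e(1) by (meson half_gt_zero subsetI)
  obtain z where z: "z \<in> C" "\<And>x. x \<in> C \<Longrightarrow> dist y z \<le> dist y x"
    using distance_attains_inf[OF \<open>closed C\<close>, of y] CS by blast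
  define R where "R = dist y z"
  have R: "R > 0" "R < e / 2"
    using y z CS(1) z(2)[OF CS(2)] by (auto simp: R_def dist_commute)
  have sub: "ball y R \<subseteq> cball p e"
  proof
    fix x assume "x \<in> ball y R"
    then show "x \<in> cball p e"
      using y(1) R dist_triangle[of p x y] by simp
  qed
  have less: "u x < M" if "x \<in> ball y R" for x
  proof -
    have "x \<notin> C" using z(2)[of x] that by (auto simp: R_def)
    then show ?thesis using sub that le[of x] e by (force simp: C_def)
  qed
  have "compact (\<beta> ` cball p e)"
    by (intro compact_continuous_image continuous_on_subset[OF \<beta>] e) simp
  then obtain K where "\<forall>v\<in>\<beta> ` cball p e. norm v \<le> K"
    using compact_imp_bounded bounded_iff by metis
  then have K: "norm (\<beta> x) \<le> K" if "x \<in> cball p e" for x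
    using that by blast
  interpret elliptic_ball u U U' \<beta> K M R y
  proof
    fix x assume "x \<in> ball y R"
    then show "GDERIV u x :> U x" "(U has_derivative U' x) (at x)"
      "(\<Sum>b\<in>Basis. U' x b \<bullet> b) + \<beta> x \<bullet> U x = 0" "norm (\<beta> x) \<le> K" "u x < M"
      using sub e(2) du dU eq K less by blast+
  qed (use R in auto)
  have z\<Omega>: "z \<in> \<Omega>" "u z = M" using z(1) CS(1) by (auto simp: S_def)
  have U0: "U z = 0"
    using interior_max_derivatives(1)[OF \<open>open \<Omega>\<close> z\<Omega>(1) du dU[OF z\<Omega>(1)]] le z\<Omega>(2) by simp
  have "isCont u z" "isCont U z"
    using du[OF z\<Omega>(1)] dU[OF z\<Omega>(1)] unfolding gderiv_def by (blast dest: has_derivative_continuous)+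
  then have "(u \<longlongrightarrow> M) (at z within ball y R)" "(U \<longlongrightarrow> 0) (at z within ball y R)"
    using z\<Omega>(2) U0 unfolding isCont_def by (auto intro: tendsto_within_subset)
  then show False
    using hopf_contradiction[of z] tendsto_inner[of U 0 _ "\<lambda>_. y - z"] by (auto simp: R_def)
qed


section \<open>The interior sphere condition\<close>

lemma holder_on_bounded:
  assumes "holder_on \<alpha> K f" "bounded K" "\<alpha> > 0"
  shows "bounded (f ` K)"
proof (cases "K = {}")
  case False
  then obtain a where a: "a \<in> K" by blast
  obtain C where C: "\<And>x y. x \<in> K \<Longrightarrow> y \<in> K \<Longrightarrow> dist (f x) (f y) \<le> C * dist x y powr \<alpha>"
    using assms(1) unfolding holder_on_def by blast
  obtain D where D: "\<And>x. x \<in> K \<Longrightarrow> dist a x \<le> D"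
    using assms(2) unfolding bounded_any_center[of K a] by blast
  have "dist (f a) (f x) \<le> \<bar>C\<bar> * D powr \<alpha>" if "x \<in> K" for x
  proof -
    have "dist (f a) (f x) \<le> C * dist a x powr \<alpha>" by (rule C[OF a that])
    also have "\<dots> \<le> \<bar>C\<bar> * dist a x powr \<alpha>" by (intro mult_right_mono) auto
    also have "\<dots> \<le> \<bar>C\<bar> * D powr \<alpha>"
      using D[OF that] assms(3) by (intro mult_left_mono powr_mono2) auto
    finally show ?thesis .
  qed
  then show ?thesis unfolding bounded_def by blast
qed simp

lemma quadratic_taylor_bound:
  fixes \<rho> :: "'a::euclidean_space \<Rightarrow> real"
  assumes G: "\<And>x. x \<in> cball a s \<Longrightarrow> GDERIV \<rho> x :> G x"
    and g: "\<And>b x. b \<in> Basis \<Longrightarrow> x \<in> cball a s \<Longrightarrow> (\<lambda>x. G x \<bullet> b) differentiable (at x)"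
    and bdd: "\<And>b c. b \<in> Basis \<Longrightarrow> c \<in> Basis \<Longrightarrow> bounded ((\<lambda>x. partial c (\<lambda>x. G x \<bullet> b) x) ` cball a s)"
  obtains L where "L \<ge> 0" "\<And>w. norm w \<le> s \<Longrightarrow> \<bar>\<rho> (a + w) - \<rho> a - G a \<bullet> w\<bar> \<le> L * (norm w)\<^sup>2"
proof -
  have "\<exists>N. \<forall>x\<in>cball a s. \<bar>partial c (\<lambda>x. G x \<bullet> b) x\<bar> \<le> N" if "b \<in> Basis" "c \<in> Basis" for b c
    using bdd[OF that] unfolding bounded_iff by auto
  then obtain N where N: "\<And>b c x. b \<in> Basis \<Longrightarrow> c \<in> Basis \<Longrightarrow> x \<in> cball a s \<Longrightarrow>
      \<bar>partial c (\<lambda>x. G x \<bullet> b) x\<bar> \<le> N b c"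
    by metis
  define L where "L = (\<Sum>b\<in>Basis. \<Sum>c\<in>Basis. \<bar>N b c\<bar>)"
  have L: "L \<ge> 0" by (simp add: L_def sum_nonneg)
  have lip: "norm (G x - G a) \<le> L * norm (x - a)" if x: "x \<in> cball a s" for x
  proof -
    have s: "a \<in> cball a s" using x by (auto intro: order_trans[OF zero_le_dist])
    have "\<bar>G x \<bullet> b - G a \<bullet> b\<bar> \<le> (\<Sum>c\<in>Basis. \<bar>N b c\<bar>) * norm (x - a)" if b: "b \<in> Basis" for b
    proof -
      let ?D = "\<lambda>x v. \<Sum>c\<in>Basis. (v \<bullet> c) *\<^sub>R partial c (\<lambda>x. G x \<bullet> b) x"
      have "norm (?D x v) \<le> (\<Sum>c\<in>Basis. \<bar>N b c\<bar>) * norm v" if "x \<in> cball a s" for x v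
        unfolding sum_distrib_right
      proof (rule order_trans[OF norm_sum], rule sum_mono)
        fix c :: 'a assume c: "c \<in> Basis"
        have "\<bar>partial c (\<lambda>x. G x \<bullet> b) x\<bar> \<le> \<bar>N b c\<bar>"
          using N[OF b c that] by linarith
        then show "norm ((v \<bullet> c) *\<^sub>R partial c (\<lambda>x. G x \<bullet> b) x) \<le> \<bar>N b c\<bar> * norm v"
          using Basis_le_norm[OF c, of v] by (simp add: abs_mult mult.commute mult_mono)
      qed
      then have "onorm (?D x) \<le> (\<Sum>c\<in>Basis. \<bar>N b c\<bar>)" if "x \<in> cball a s" for x
        using that by (intro onorm_le)
      moreover have "((\<lambda>x. G x \<bullet> b) has_derivative ?D x) (at x within cball a s)" if "x \<in> cball a s" for x
        by (rule has_derivative_at_withinI[OF has_derivative_partial[OF g[OF b that]]])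
      ultimately have "norm (G x \<bullet> b - G a \<bullet> b) \<le> (\<Sum>c\<in>Basis. \<bar>N b c\<bar>) * norm (x - a)"
        by (intro differentiable_bound[OF convex_cball _ _ x s])
      then show ?thesis by simp
    qed
    then have "(\<Sum>b\<in>Basis. \<bar>(G x - G a) \<bullet> b\<bar>) \<le> (\<Sum>b\<in>Basis. (\<Sum>c\<in>Basis. \<bar>N b c\<bar>) * norm (x - a))"
      by (intro sum_mono) (simp add: inner_diff_left)
    then show ?thesis
      using norm_le_l1[of "G x - G a"] by (simp add: L_def sum_distrib_right)
  qed
  show thesis
  proof (rule that[OF L])
    fix w :: 'a assume w: "norm w \<le> s"
    have sub: "x \<in> cball a s" if "x \<in> cball a (norm w)" for x
      using that w by simp
    have "norm ((\<rho> (a + w) - G a \<bullet> (a + w)) - (\<rho> a - G a \<bullet> a)) \<le> (L * norm w) * norm ((a + w) - a)"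
    proof (rule differentiable_bound[where S = "cball a (norm w)" and f' = "\<lambda>x v. v \<bullet> (G x - G a)"])
      fix x assume x: "x \<in> cball a (norm w)"
      show "((\<lambda>x. \<rho> x - G a \<bullet> x) has_derivative (\<lambda>v. v \<bullet> (G x - G a))) (at x within cball a (norm w))"
        by (rule has_derivative_at_withinI)
          (auto intro!: derivative_eq_intros G[OF sub[OF x], unfolded gderiv_def] simp: inner_diff_right inner_commute)
      show "onorm (\<lambda>v. v \<bullet> (G x - G a)) \<le> L * norm w"
      proof (rule onorm_le)
        fix v
        have "norm (v \<bullet> (G x - G a)) \<le> norm v * norm (G x - G a)"
          using Cauchy_Schwarz_ineq2 by simp
        also have "norm (G x - G a) \<le> L * norm w"
          using lip[OF sub[OF x]] mult_left_mono[OF _ L, of "norm (x - a)" "norm w"] x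
          by (simp add: dist_norm norm_minus_commute)
        finally show "norm (v \<bullet> (G x - G a)) \<le> L * norm w * norm v"
          by (simp add: mult_left_mono mult.commute[of "L * norm w"])
      qed
    qed (auto simp: dist_norm)
    then show "\<bar>\<rho> (a + w) - \<rho> a - G a \<bullet> w\<bar> \<le> L * (norm w)\<^sup>2"
      by (simp add: inner_add_right power2_eq_square algebra_simps)
  qed
qed

text \<open>
  The interior sphere condition, with the centre on the given normal. Near \<open>x\<^sub>0\<close> the domain is
  \<open>{\<rho> > 0}\<close> for \<open>\<rho> = \<psi> \<bullet> e\<close>, which vanishes at \<open>x\<^sub>0\<close> and has a quadratic Taylor bound. Curves in the
  straightened boundary show that all vectors orthogonal to \<open>\<nabla>\<rho>(x\<^sub>0)\<close> are tangent, so that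
  \<open>\<nabla>\<rho>(x\<^sub>0)\<close> is a negative multiple of \<open>n\<close>.
\<close>

lemma interior_ball_at_boundary:
  fixes \<Omega> :: "'a::euclidean_space set"
  assumes "open \<Omega>" "\<alpha> > 0" and smooth: "Ck_holder_boundary 2 \<alpha> \<Omega>" and x0: "x\<^sub>0 \<in> frontier \<Omega>"
    and n: "outer_unit_normal \<Omega> x\<^sub>0 n"
  obtains R where "R > 0" "ball (x\<^sub>0 - R *\<^sub>R n) R \<subseteq> \<Omega>"
proof -
  obtain r e and \<psi> :: "'a \<Rightarrow> 'a" where r: "r > 0" and e: "e \<in> Basis" and inj: "inj_on \<psi> (ball x\<^sub>0 r)"
    and op: "open (\<psi> ` ball x\<^sub>0 r)"
    and pos: "\<psi> ` (ball x\<^sub>0 r \<inter> \<Omega>) \<subseteq> {y. y \<bullet> e > 0}"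
    and zero: "\<psi> ` (ball x\<^sub>0 r \<inter> frontier \<Omega>) \<subseteq> {y. y \<bullet> e = 0}"
    and C\<psi>: "Ck_holder_on 2 \<alpha> (ball x\<^sub>0 r) \<psi>"
    and C\<phi>: "Ck_holder_on 2 \<alpha> (\<psi> ` ball x\<^sub>0 r) (the_inv_into (ball x\<^sub>0 r) \<psi>)"
    using bspec[OF smooth[unfolded Ck_holder_boundary_def] x0] unfolding Let_def
    by (elim exE bexE conjE) (rule that)
  define B where "B = ball x\<^sub>0 r"
  define \<phi> where "\<phi> = the_inv_into B \<psi>"
  have x0B: "x\<^sub>0 \<in> B" using r by (simp add: B_def)
  have \<phi>\<psi>: "\<phi> (\<psi> x) = x" if "x \<in> B" for x
    using the_inv_into_f_f[OF inj] that by (simp add: \<phi>_def B_def)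
  have \<psi>\<phi>: "\<psi> (\<phi> y) = y" "\<phi> y \<in> B" if "y \<in> \<psi> ` B" for y
    using that \<phi>\<psi> by auto
  have d\<psi>: "\<psi> differentiable (at x)" if "x \<in> B" for x
    using C\<psi> that by (simp add: numeral_2_eq_2 B_def)
  have d2\<psi>: "partial b \<psi> differentiable (at x)" if "x \<in> B" "b \<in> Basis" for x b
    using C\<psi> that by (simp add: numeral_2_eq_2 B_def)
  have d3\<psi>: "bounded (partial c (partial b \<psi>) ` K)"
    if "b \<in> Basis" "c \<in> Basis" "compact K" "K \<subseteq> B" for b c K
    using C\<psi> that \<open>\<alpha> > 0\<close>
    by (intro holder_on_bounded[of \<alpha>] compact_imp_bounded) (auto simp: numeral_2_eq_2 B_def)
  have d\<phi>: "\<phi> differentiable (at y)" if "y \<in> \<psi> ` B" for y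
    using C\<phi> that by (auto simp: numeral_2_eq_2 B_def \<phi>_def)
  have cont\<phi>: "continuous_on (\<psi> ` B) \<phi>"
    by (simp add: continuous_at_imp_continuous_on d\<phi> differentiable_imp_continuous_within)
  have cont\<psi>: "isCont \<psi> x\<^sub>0"
    using d\<psi>[OF x0B] by (simp add: differentiable_imp_continuous_within)

  define \<rho> where "\<rho> x = \<psi> x \<bullet> e" for x
  have \<rho>0: "\<rho> x\<^sub>0 = 0" using zero x0 x0B unfolding \<rho>_def B_def by blast
  obtain s where s: "s > 0" "ball (\<psi> x\<^sub>0) s \<subseteq> \<psi> ` B"
    using op x0B by (metis B_def image_eqI open_contains_ball)
  define P where "P = ball (\<psi> x\<^sub>0) s \<inter> {y. y \<bullet> e > 0}"
  obtain \<delta>0 where \<delta>0: "\<delta>0 > 0" "\<And>x. dist x x\<^sub>0 < \<delta>0 \<Longrightarrow> dist (\<psi> x) (\<psi> x\<^sub>0) < s"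
    using cont\<psi> s(1) unfolding continuous_at_eps_delta by blast
  have PB: "P \<subseteq> \<psi> ` B" using s by (auto simp: P_def)
  \<comment> \<open>The preimage of the half ball \<open>P\<close> is connected, misses the boundary and meets the domain.\<close>
  have "\<phi> ` P \<subseteq> \<Omega>"
  proof -
    have "convex P"
      unfolding P_def using convex_halfspace_gt[of 0 e]
      by (intro convex_Int convex_ball) (simp add: inner_commute)
    then have "connected (\<phi> ` P)"
      using connected_continuous_image continuous_on_subset[OF cont\<phi> PB] convex_connected by blast
    moreover have "\<phi> ` P \<inter> frontier \<Omega> = {}"
    proof (rule ccontr)
      assume "\<phi> ` P \<inter> frontier \<Omega> \<noteq> {}"
      then obtain y where y: "y \<in> P" "\<phi> y \<in> frontier \<Omega>" by blast
      then have "\<psi> (\<phi> y) \<bullet> e = 0" using zero \<psi>\<phi>(2) PB unfolding B_def by blast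
      then show False using y \<psi>\<phi>(1) PB by (auto simp: P_def)
    qed
    moreover have "\<phi> ` P \<inter> \<Omega> \<noteq> {}"
    proof -
      have "x\<^sub>0 \<in> closure \<Omega>" using x0 by (simp add: frontier_def)
      then obtain q where q: "q \<in> \<Omega>" "dist q x\<^sub>0 < min r \<delta>0"
        using r \<delta>0 unfolding closure_approachable by (metis min_less_iff_conj)
      then have "q \<in> B" by (simp add: B_def dist_commute)
      moreover have "\<psi> q \<bullet> e > 0" using pos q(1) \<open>q \<in> B\<close> unfolding B_def by blast
      then have "\<psi> q \<in> P" using q \<delta>0(2)[of q] by (simp add: P_def dist_commute)
      ultimately show ?thesis using q \<phi>\<psi> by (metis IntI empty_iff image_eqI)
    qed
    ultimately show ?thesis using connected_Int_frontier by blast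
  qed
  define \<delta> where "\<delta> = min r \<delta>0 / 2"
  have \<delta>: "\<delta> > 0" "\<delta> < r" using r \<delta>0 by (auto simp: \<delta>_def)
  have inside: "x \<in> \<Omega>" if "norm (x - x\<^sub>0) \<le> \<delta>" "\<rho> x > 0" for x
  proof -
    have "x \<in> B" "dist x x\<^sub>0 < \<delta>0"
      using that \<delta> r \<delta>0(1) by (auto simp: B_def dist_norm norm_minus_commute \<delta>_def)
    moreover have "\<psi> x \<in> P"
      using \<delta>0(2)[OF \<open>dist x x\<^sub>0 < \<delta>0\<close>] that by (simp add: P_def \<rho>_def dist_commute)
    ultimately show ?thesis using \<open>\<phi> ` P \<subseteq> \<Omega>\<close> \<phi>\<psi> by (metis image_subset_iff)
  qed

  define G where "G x = (\<Sum>b\<in>Basis. (partial b \<psi> x \<bullet> e) *\<^sub>R b)" for x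
  have Gb: "(\<lambda>x. G x \<bullet> b) = (\<lambda>x. partial b \<psi> x \<bullet> e)" if "b \<in> Basis" for b
  proof
    fix x
    have "G x \<bullet> b = (\<Sum>i\<in>Basis. if i = b then partial i \<psi> x \<bullet> e else 0)"
      unfolding G_def inner_sum_left using that by (intro sum.cong) (auto simp: inner_Basis)
    then show "G x \<bullet> b = partial b \<psi> x \<bullet> e" using that by simp
  qed
  have G: "frechet_derivative \<psi> (at x) v \<bullet> e = v \<bullet> G x" if "x \<in> B" for x v
    using frechet_derivative_partial[OF d\<psi>[OF that], of v]
    by (simp add: G_def inner_sum_left inner_sum_right mult.commute)
  have G\<rho>: "GDERIV \<rho> x :> G x" if "x \<in> B" for x
    using has_derivative_inner_left[of \<psi> "frechet_derivative \<psi> (at x)" "at x" e] d\<psi>[OF that] G[OF that]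
    unfolding gderiv_def \<rho>_def [abs_def] by (simp add: frechet_derivative_works)
  have \<delta>B: "cball x\<^sub>0 \<delta> \<subseteq> B" using \<delta> by (auto simp: B_def)
  obtain L where L: "L \<ge> 0"
    "\<And>w. norm w \<le> \<delta> \<Longrightarrow> \<bar>\<rho> (x\<^sub>0 + w) - \<rho> x\<^sub>0 - G x\<^sub>0 \<bullet> w\<bar> \<le> L * (norm w)\<^sup>2"
  proof (rule quadratic_taylor_bound[of x\<^sub>0 \<delta> \<rho> G])
    fix b c :: 'a assume bc: "b \<in> Basis" "c \<in> Basis"
    have "bounded ((\<lambda>z. z \<bullet> e) ` partial c (partial b \<psi>) ` cball x\<^sub>0 \<delta>)"
      by (rule bounded_linear_image[OF d3\<psi>[OF bc compact_cball \<delta>B] bounded_linear_inner_left])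
    also have "(\<lambda>z. z \<bullet> e) ` partial c (partial b \<psi>) ` cball x\<^sub>0 \<delta> = (\<lambda>x. partial c (\<lambda>x. G x \<bullet> b) x) ` cball x\<^sub>0 \<delta>"
      unfolding image_image Gb[OF bc(1)]
      using partial_inner[OF d2\<psi>] \<delta>B bc(1) by (intro image_cong refl) (auto simp: subset_iff)
    finally show "bounded \<dots>" .
  next
    fix b x :: 'a assume "b \<in> Basis" "x \<in> cball x\<^sub>0 \<delta>"
    then show "(\<lambda>x. G x \<bullet> b) differentiable (at x)"
      using d2\<psi>[of x b] \<delta>B Gb by (auto intro!: differentiable_inner simp del: mem_cball)
  qed (use \<delta>B G\<rho> in blast)+

  have tangent: "v \<in> tangent_vectors (frontier \<Omega>) x\<^sub>0" if v: "v \<bullet> G x\<^sub>0 = 0" for v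
  proof -
    let ?D = "frechet_derivative \<psi> (at x\<^sub>0)" and ?E = "frechet_derivative \<phi> (at (\<psi> x\<^sub>0))"
    have D: "(\<psi> has_derivative ?D) (at x\<^sub>0)" "(\<phi> has_derivative ?E) (at (\<psi> x\<^sub>0))"
      using d\<psi>[OF x0B] d\<phi> x0B by (auto simp: frechet_derivative_works)
    have "((\<lambda>x. \<phi> (\<psi> x)) has_derivative (\<lambda>v. ?E (?D v))) (at x\<^sub>0)"
      by (rule has_derivative_compose[OF D])
    then have "((\<lambda>x. x) has_derivative (\<lambda>v. ?E (?D v))) (at x\<^sub>0)"
      by (rule has_derivative_transform_within_open[of _ _ _ _ B]) (use x0B \<phi>\<psi> in \<open>auto simp: B_def\<close>)
    then have ED: "?E (?D v) = v"
      using has_derivative_unique[OF has_derivative_ident] by metis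
    define \<gamma> where "\<gamma> t = \<phi> (\<psi> x\<^sub>0 + t *\<^sub>R ?D v)" for t
    define \<epsilon> where "\<epsilon> = s / (norm (?D v) + 1)"
    have \<epsilon>: "\<epsilon> > 0" using s by (simp add: \<epsilon>_def add_nonneg_pos)
    have front: "\<gamma> t \<in> frontier \<Omega>" if t: "\<bar>t\<bar> < \<epsilon>" for t
    proof -
      define y where "y = \<psi> x\<^sub>0 + t *\<^sub>R ?D v"
      have "\<bar>t\<bar> * norm (?D v) \<le> \<bar>t\<bar> * (norm (?D v) + 1)" by (simp add: mult_left_mono)
      also have "\<dots> < s" using t by (simp add: \<epsilon>_def pos_less_divide_eq add_nonneg_pos)
      finally have y: "y \<in> ball (\<psi> x\<^sub>0) s" by (simp add: y_def dist_norm)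
      have ye: "y \<bullet> e = 0"
        using \<rho>0 G[OF x0B, of v] v by (simp add: y_def inner_add_left \<rho>_def)
      have yB: "y \<in> \<psi> ` B" using y s by blast
      have "\<phi> y \<notin> \<Omega>"
      proof
        assume "\<phi> y \<in> \<Omega>"
        then have "\<psi> (\<phi> y) \<bullet> e > 0" using pos \<psi>\<phi>(2)[OF yB] unfolding B_def by blast
        then show False using \<psi>\<phi>(1)[OF yB] ye by simp
      qed
      moreover have "\<phi> y \<in> closure \<Omega>"
      proof (rule Lim_in_closed_set[of _ "\<lambda>\<tau>. \<phi> (y + \<tau> *\<^sub>R e)" "at_right (0::real)"])
        have lim: "((\<lambda>\<tau>. y + \<tau> *\<^sub>R e) \<longlongrightarrow> y + 0 *\<^sub>R e) (at_right (0::real))"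
          by (intro tendsto_intros)
        have "isCont \<phi> y"
          using d\<phi>[OF yB] by (simp add: differentiable_imp_continuous_within)
        then show "((\<lambda>\<tau>. \<phi> (y + \<tau> *\<^sub>R e)) \<longlongrightarrow> \<phi> y) (at_right 0)"
          using isCont_tendsto_compose[of y \<phi> "\<lambda>\<tau>. y + \<tau> *\<^sub>R e"] lim by simp
        have "\<forall>\<^sub>F \<tau> in at_right (0::real). y + \<tau> *\<^sub>R e \<in> ball (\<psi> x\<^sub>0) s"
          using topological_tendstoD[OF lim, of "ball (\<psi> x\<^sub>0) s"] y by simp
        moreover have "\<forall>\<^sub>F \<tau> in at_right (0::real). \<tau> > 0"
          by (rule eventually_at_right_less)
        ultimately show "\<forall>\<^sub>F \<tau> in at_right 0. \<phi> (y + \<tau> *\<^sub>R e) \<in> closure \<Omega>"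
        proof eventually_elim
          case (elim \<tau>)
          then have "y + \<tau> *\<^sub>R e \<in> P" using e ye by (simp add: P_def inner_add_left)
          then show ?case using \<open>\<phi> ` P \<subseteq> \<Omega>\<close> closure_subset by blast
        qed
      qed auto
      ultimately show ?thesis
        using \<open>open \<Omega>\<close> by (simp add: frontier_def interior_open \<gamma>_def y_def)
    qed
    have "((\<lambda>t. \<psi> x\<^sub>0 + t *\<^sub>R ?D v) has_derivative (\<lambda>t. t *\<^sub>R ?D v)) (at (0::real))"
      by (auto intro!: derivative_eq_intros)
    from has_derivative_compose[OF this, of \<phi> ?E] D(2)
    have "(\<gamma> has_derivative (\<lambda>t. ?E (t *\<^sub>R ?D v))) (at 0)" by (simp add: \<gamma>_def[abs_def])
    moreover have "?E (t *\<^sub>R ?D v) = t *\<^sub>R v" for t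
      using linear_scale[OF has_derivative_linear[OF D(2)]] ED by simp
    ultimately have "(\<gamma> has_vector_derivative v) (at 0)"
      by (simp add: has_vector_derivative_def)
    moreover have "\<gamma> 0 = x\<^sub>0" using \<phi>\<psi>[OF x0B] by (simp add: \<gamma>_def)
    ultimately show ?thesis
      unfolding tangent_vectors_def using \<epsilon> front by (intro CollectI exI[of _ \<gamma>] exI[of _ \<epsilon>]) auto
  qed

  have n1: "norm n = 1" "n \<bullet> n = 1" and n_perp: "\<And>v. v \<bullet> G x\<^sub>0 = 0 \<Longrightarrow> v \<bullet> n = 0"
    and n_in: "\<forall>\<^sub>F t in at_right 0. x\<^sub>0 - t *\<^sub>R n \<in> \<Omega>"
    using n tangent unfolding outer_unit_normal_def
    by (auto simp: norm_eq_1 elim: eventually_mono)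
  define \<kappa> where "\<kappa> = - (G x\<^sub>0 \<bullet> n)"
  have G0: "G x\<^sub>0 = (- \<kappa>) *\<^sub>R n"
  proof -
    let ?g = "G x\<^sub>0"
    \<comment> \<open>Testing with this vector gives equality in the Cauchy-Schwarz inequality for \<open>?g\<close> and \<open>n\<close>.\<close>
    have "((?g \<bullet> ?g) *\<^sub>R n - (n \<bullet> ?g) *\<^sub>R ?g) \<bullet> n = 0"
      by (rule n_perp) (simp add: inner_diff_left)
    then have "(?g - (?g \<bullet> n) *\<^sub>R n) \<bullet> (?g - (?g \<bullet> n) *\<^sub>R n) = 0"
      using n1 by (simp add: inner_diff_left inner_diff_right inner_commute algebra_simps)
    then show ?thesis by (simp add: \<kappa>_def)
  qed
  \<comment> \<open>If \<open>\<kappa>\<close> were zero then \<open>n\<close> itself would be tangent.\<close>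
  have "\<kappa> \<noteq> 0" using G0 n_perp[of n] n1 by auto
  moreover have "\<not> \<kappa> < 0"
  proof
    assume neg: "\<kappa> < 0"
    define \<tau> where "\<tau> = min \<delta> (- \<kappa> / (L + 1))"
    have "- \<kappa> / (L + 1) > 0" using neg L(1) by (intro divide_pos_pos) auto
    then have \<tau>: "\<tau> > 0" using \<delta> by (simp add: \<tau>_def)
    have "\<forall>\<^sub>F t in at_right 0. x\<^sub>0 - t *\<^sub>R n \<in> \<Omega> \<and> t \<in> {0<..<\<tau>}"
      by (intro eventually_conj n_in eventually_at_rightI[of 0 \<tau>]) (use \<tau> in auto)
    then obtain t where t: "x\<^sub>0 - t *\<^sub>R n \<in> \<Omega>" "0 < t" "t < \<tau>"
      using eventually_happens[of _ "at_right (0::real)"] by (auto simp: trivial_limit_at_right_real)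
    have td: "t \<le> \<delta>" "t < - \<kappa> / (L + 1)" using t(3) by (auto simp: \<tau>_def)
    then have tL: "t * (L + 1) < - \<kappa>" using L(1) pos_less_divide_eq[of "L + 1" t "- \<kappa>"] by simp
    have "x\<^sub>0 - t *\<^sub>R n \<in> B" using td t n1 \<delta> by (simp add: B_def dist_norm)
    then have "\<rho> (x\<^sub>0 - t *\<^sub>R n) > 0" using pos t(1) unfolding \<rho>_def B_def by blast
    moreover have "\<rho> (x\<^sub>0 + - t *\<^sub>R n) - G x\<^sub>0 \<bullet> (- t *\<^sub>R n) \<le> L * t\<^sup>2"
      using L(2)[of "- t *\<^sub>R n"] td t n1 \<rho>0 by simp
    moreover have "G x\<^sub>0 \<bullet> (- t *\<^sub>R n) = t * \<kappa>" using G0 n1 by simp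
    moreover have "t * (t * (L + 1)) < t * (- \<kappa>)" using tL t(2) by (rule mult_strict_left_mono)
    ultimately show False by (simp add: power2_eq_square algebra_simps) (smt (verit) t(2) mult_pos_pos)
  qed
  ultimately have \<kappa>: "\<kappa> > 0" by simp
  define R where "R = min (\<delta> / 2) (\<kappa> / (2 * (L + 1)))"
  have R: "R > 0" "2 * R \<le> \<delta>" using \<delta> \<kappa> L(1) by (auto simp: R_def add_nonneg_pos)
  have "R \<le> \<kappa> / (2 * (L + 1))" by (simp add: R_def)
  then have RL: "2 * R * L < \<kappa>"
    using L(1) R(1) by (simp add: pos_le_divide_eq add_nonneg_pos algebra_simps)
  show thesis
  proof (rule that[OF R(1)], rule subsetI)
    fix x assume x: "x \<in> ball (x\<^sub>0 - R *\<^sub>R n) R"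
    define w where "w = x - x\<^sub>0"
    have wn: "norm (w + R *\<^sub>R n) < R"
      using x by (simp add: w_def dist_norm norm_minus_commute algebra_simps)
    then have "w \<noteq> 0" using n1 R by auto
    have "(norm (w + R *\<^sub>R n))\<^sup>2 < R\<^sup>2" using wn by (intro power_strict_mono) auto
    moreover have "(norm (w + R *\<^sub>R n))\<^sup>2 = (norm w)\<^sup>2 + 2 * R * (w \<bullet> n) + R\<^sup>2"
      unfolding power2_norm_eq_inner using n1(2)
      by (simp add: inner_add_left inner_add_right inner_commute[of n w] power2_eq_square algebra_simps)
    ultimately have q: "(norm w)\<^sup>2 < 2 * R * (- (w \<bullet> n))" by simp
    have "norm w \<le> norm (w + R *\<^sub>R n) + norm (- (R *\<^sub>R n))"
      using norm_triangle_ineq[of "w + R *\<^sub>R n" "- (R *\<^sub>R n)"] by simp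
    then have wd: "norm w \<le> \<delta>" using wn n1 R by simp
    have "2 * R * (L * (norm w)\<^sup>2) \<le> \<kappa> * (norm w)\<^sup>2"
      using RL mult_right_mono[of "2 * R * L" \<kappa> "(norm w)\<^sup>2"] by (simp add: algebra_simps)
    also have "\<dots> < \<kappa> * (2 * R * (- (w \<bullet> n)))"
      using q \<kappa> by (rule mult_strict_left_mono)
    also have "\<dots> = 2 * R * (G x\<^sub>0 \<bullet> w)"
      by (simp add: G0 inner_commute)
    finally have "L * (norm w)\<^sup>2 < G x\<^sub>0 \<bullet> w" using R by simp
    then have "\<rho> (x\<^sub>0 + w) > 0" using L(2)[OF wd] \<rho>0 by simp
    then show "x \<in> \<Omega>" using inside[of x] wd by (simp add: w_def)
  qed
qed


section \<open>Solutions have a constant first integral\<close>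

text \<open>
  The data of the problem, with \<open>k\<close> for \<open>\<sigma>\<^sup>2 / 2\<close> and \<open>F\<close> for the continuous extension of \<open>h\<close> to
  \<open>closure \<Omega> \<times> (0,\<infinity>)\<close>.
\<close>

locale brs_data =
  fixes k :: real and \<Omega> :: "'a::euclidean_space set" and h :: "'a \<Rightarrow> real \<Rightarrow> real" and F :: "'a \<times> real \<Rightarrow> real"
  assumes k: "k > 0"
    and \<Omega>: "open \<Omega>" "connected \<Omega>" "bounded \<Omega>" "\<Omega> \<noteq> {}"
    and mono: "\<And>x. x \<in> \<Omega> \<Longrightarrow> mono_on {0<..} (h x)"
    and bounded_h: "\<And>s. s > 0 \<Longrightarrow> \<exists>N. \<forall>x\<in>\<Omega>. \<bar>h x s\<bar> \<le> N"
    and C2: "Ck_on 2 (\<Omega> \<times> {0<..}) (\<lambda>(x, s). h x s)"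
    and F: "continuous_on (closure \<Omega> \<times> {0<..}) F"
    and F_eq: "\<And>x s. x \<in> \<Omega> \<Longrightarrow> s > 0 \<Longrightarrow> F (x, s) = h x s"
    and F_partial: "\<And>b. b \<in> Basis \<Longrightarrow> extends_continuously (\<Omega> \<times> {0<..}) (closure \<Omega> \<times> {0<..}) (partial b (\<lambda>(x, s). h x s))"
begin

text \<open>
  Multiplied by \<open>m\<close>, this gradient is the negative flux \<open>k \<nabla>m + m \<nabla>[h(x,m)]\<close> of the system.
\<close>

lemma first_integral_gradient:
  assumes pos: "\<And>x. x \<in> \<Omega> \<Longrightarrow> m x > 0" and m: "m differentiable (at x)" and x: "x \<in> \<Omega>"
  shows "GDERIV (\<lambda>x. k * ln (m x) + h x (m x)) x :> (k / m x) *\<^sub>R grad m x + grad (\<lambda>z. h z (m z)) x"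
proof -
  have "(\<lambda>(x, s). h x s) differentiable (at (x, m x))"
    using C2 x pos unfolding Ck_on_2 by blast
  from partial_graph(1)[OF this m] have "(\<lambda>z. h z (m z)) differentiable (at x)"
    unfolding differentiable_def by auto
  note H = GDERIV_grad[OF this, unfolded gderiv_def]
  note m' = GDERIV_grad[OF m, unfolded gderiv_def]
  show ?thesis
    unfolding gderiv_def using pos[OF x]
    by (auto intro!: derivative_eq_intros H m' simp: inner_add_right field_simps)
qed

text \<open>
  Every solution has a constant first integral \<open>u = k ln m + h(x,m)\<close>. A solution is not known to be
  positive on the boundary; but where \<open>m\<close> is small, so is \<open>u\<close>, because \<open>h(x,\<cdot>)\<close> is nondecreasing.
  Hence \<open>u\<close> attains its supremum at a point of the closure where the continuous extension of \<open>m\<close> is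
  positive. At a boundary point Hopf's lemma applies in a small interior ball, on which the drift
  \<open>\<nabla>m / m\<close> is bounded; at an interior point the strong maximum principle applies.
\<close>

lemma first_integral_constant:
  assumes \<nu>: "\<And>x. x \<in> frontier \<Omega> \<Longrightarrow> norm (\<nu> x) = 1"
      "\<And>x. x \<in> frontier \<Omega> \<Longrightarrow> \<exists>R>0. ball (x - R *\<^sub>R \<nu> x) R \<subseteq> \<Omega>"
    and pos: "\<And>x. x \<in> \<Omega> \<Longrightarrow> m x > 0" and m2: "Ck_on 2 \<Omega> m" and m1: "C1_upto \<Omega> (closure \<Omega>) m"
    and eq: "\<And>x. x \<in> \<Omega> \<Longrightarrow> k * laplacian m x + divergence (\<lambda>y. m y *\<^sub>R grad (\<lambda>z. h z (m z)) y) x = 0"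
    and bc: "\<And>x. x \<in> frontier \<Omega> \<Longrightarrow> \<exists>p q. (grad m \<longlongrightarrow> p) (at x within \<Omega>) \<and>
        ((\<lambda>y. m y *\<^sub>R grad (\<lambda>z. h z (m z)) y) \<longlongrightarrow> q) (at x within \<Omega>) \<and> k * (p \<bullet> \<nu> x) + q \<bullet> \<nu> x = 0"
  obtains c where "\<And>x. x \<in> \<Omega> \<Longrightarrow> k * ln (m x) + h x (m x) = c"
proof -
  define H where "H z = h z (m z)" for z
  define u where "u x = k * ln (m x) + h x (m x)" for x
  define U where "U x = (k / m x) *\<^sub>R grad m x + grad H x" for x
  define \<beta> where "\<beta> x = inverse (m x) *\<^sub>R grad m x" for x
  have md: "m differentiable (at x)" "grad m differentiable (at x)" if "x \<in> \<Omega>" for x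
    using m2 grad_differentiable that unfolding Ck_on_2 by blast+
  have "Ck_on 2 \<Omega> (\<lambda>x. (\<lambda>(x, s). h x s) (x, m x))"
    by (rule Ck_on_2_graph[OF C2 m2 _ \<Omega>(1)]) (use pos in auto)
  then have H2: "Ck_on 2 \<Omega> H" by (simp add: H_def[abs_def])
  have Hd: "grad H differentiable (at x)" if "x \<in> \<Omega>" for x
    using H2 grad_differentiable that by blast
  have m_cont: "continuous_on \<Omega> m" "continuous_on \<Omega> (grad m)"
    using Ck_on_2_imp_1[OF m2] Ck_on_1_imp_continuous continuous_on_grad by blast+
  have Ud: "U differentiable (at x)" if "x \<in> \<Omega>" for x
    unfolding U_def using md[OF that] Hd[OF that] pos[OF that]
    by (intro differentiable_add differentiable_scaleR differentiable_divide) auto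
  have u: "GDERIV u x :> U x" if "x \<in> \<Omega>" for x
    using first_integral_gradient[OF pos md(1) that] that by (simp add: u_def[abs_def] U_def H_def[abs_def])
  have U: "(U has_derivative (\<lambda>b. partial b U x)) (at x)" if "x \<in> \<Omega>" for x
    using Ud[OF that] by (simp add: partial_def frechet_derivative_works)
  have flux: "k *\<^sub>R grad m x + m x *\<^sub>R grad H x = m x *\<^sub>R U x" if "x \<in> \<Omega>" for x
    using pos[OF that] by (simp add: U_def scaleR_add_right)
  have elliptic: "(\<Sum>b\<in>Basis. partial b U x \<bullet> b) + \<beta> x \<bullet> U x = 0" if x: "x \<in> \<Omega>" for x
  proof -
    have "(\<lambda>y. m y *\<^sub>R grad H y) differentiable (at x)"
      using md[OF x] Hd[OF x] by (intro differentiable_scaleR) auto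
    then have "k * divergence (grad m) x + divergence (\<lambda>y. m y *\<^sub>R grad H y) x
        = divergence (\<lambda>y. k *\<^sub>R grad m y + m y *\<^sub>R grad H y) x"
      using divergence_scaleR_add[OF md(2)[OF x]] by simp
    also have "\<dots> = divergence (\<lambda>y. m y *\<^sub>R U y) x"
      using flux by (rule divergence_cong_open[OF \<Omega>(1) x])
    also have "\<dots> = grad m x \<bullet> U x + m x * divergence U x"
      by (rule divergence_scaleR[OF md(1)[OF x] Ud[OF x]])
    finally have "grad m x \<bullet> U x + m x * divergence U x = 0"
      using eq[OF x] divergence_grad[OF md(2)[OF x]] by (simp add: H_def[abs_def])
    then have "grad m x \<bullet> U x = - m x * divergence U x" by simp
    then show ?thesis
      using pos[OF x] by (simp add: \<beta>_def flip: divergence_def)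
  qed
  have \<beta>_cont: "continuous_on \<Omega> \<beta>"
    unfolding \<beta>_def using pos by (intro continuous_intros m_cont) force

  obtain mb where mb: "continuous_on (closure \<Omega>) mb" "\<And>x. x \<in> \<Omega> \<Longrightarrow> mb x = m x"
    using m1 unfolding C1_upto_def extends_continuously_def by blast
  define D where "D = {x \<in> closure \<Omega>. mb x > 0}"
  define ub where "ub x = k * ln (mb x) + F (x, mb x)" for x
  have D: "\<Omega> \<subseteq> D" using mb(2) pos closure_subset by (auto simp: D_def)
  have mbD: "continuous_on D mb"
    by (rule continuous_on_subset[OF mb(1)]) (auto simp: D_def)
  have "continuous_on D (\<lambda>x. F (x, mb x))"
    by (rule continuous_on_compose2[OF F continuous_on_Pair[OF continuous_on_id mbD]]) (auto simp: D_def)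
  then have ub_cont: "continuous_on D ub"
    unfolding ub_def by (intro continuous_intros mbD) (auto simp: D_def)
  have ub: "ub x = u x" if "x \<in> \<Omega>" for x
    using that mb(2) F_eq pos by (simp add: ub_def u_def)

  obtain x1 where x1: "x1 \<in> \<Omega>" using \<Omega>(4) by blast
  obtain N where N: "\<And>x. x \<in> \<Omega> \<Longrightarrow> \<bar>h x 1\<bar> \<le> N" using bounded_h[of 1] by auto
  \<comment> \<open>The maximum of \<open>u\<close> is to be sought where \<open>m \<ge> s\<close>: below this value \<open>u\<close> is less than \<open>u x1\<close>.\<close>
  define s where "s = min 1 (exp ((u x1 - N) / k))"
  have s: "s > 0" "s \<le> 1" by (auto simp: s_def)
  have small: "u x < u x1" if x: "x \<in> \<Omega>" "m x < s" for x
  proof -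
    have "ln (m x) < ln (exp ((u x1 - N) / k))"
      using x pos[OF x(1)] by (subst ln_less_cancel_iff) (auto simp: s_def)
    then have "k * ln (m x) < u x1 - N"
      using k by (simp add: pos_less_divide_eq mult.commute)
    moreover have "h x (m x) \<le> h x 1"
      using mono[OF x(1)] x s(2) pos[OF x(1)] by (auto simp: mono_on_def)
    ultimately show ?thesis using N[OF x(1)] by (auto simp: u_def)
  qed
  define A where "A = closure \<Omega> \<inter> mb -` {s..}"
  have "compact A"
  proof -
    have "closed A"
      unfolding A_def by (intro continuous_closed_preimage mb) auto
    then show ?thesis
      using \<Omega>(3) by (auto simp: compact_eq_bounded_closed A_def intro: bounded_subset[OF bounded_closure])
  qed
  moreover have x1A: "x1 \<in> A"
    using small[OF x1] x1 mb(2)[OF x1] closure_subset by (force simp: A_def)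
  moreover have AD: "A \<subseteq> D" using s by (auto simp: A_def D_def)
  ultimately obtain a where a: "a \<in> A" "\<And>x. x \<in> A \<Longrightarrow> ub x \<le> ub a"
    using continuous_attains_sup[of A ub] continuous_on_subset[OF ub_cont] by blast
  define M where "M = ub a"
  have le: "u x \<le> M" if x: "x \<in> \<Omega>" for x
  proof (cases "m x < s")
    case True
    then show ?thesis using small[OF x] a(2)[OF x1A] ub[OF x1] by (simp add: M_def)
  next
    case False
    then have "x \<in> A" using x mb(2) closure_subset by (auto simp: A_def)
    then show ?thesis using a(2)[of x] ub[OF x] by (simp add: M_def)
  qed
  note smp = strong_maximum_principle[OF \<Omega>(1,2) u U elliptic \<beta>_cont le]
  have "\<exists>x\<in>\<Omega>. u x = M"
  proof (rule ccontr)
    assume none: "\<not> (\<exists>x\<in>\<Omega>. u x = M)"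
    then have less: "u x < M" if "x \<in> \<Omega>" for x using le[OF that] that by force
    have "a \<notin> \<Omega>" using none ub M_def by auto
    then have af: "a \<in> frontier \<Omega>" using a(1) \<Omega>(1) by (simp add: A_def frontier_def interior_open)
    obtain R0 where R0: "R0 > 0" "ball (a - R0 *\<^sub>R \<nu> a) R0 \<subseteq> \<Omega>" using \<nu>(2)[OF af] by blast
    obtain p q where p: "(grad m \<longlongrightarrow> p) (at a within \<Omega>)"
      and q: "((\<lambda>y. m y *\<^sub>R grad H y) \<longlongrightarrow> q) (at a within \<Omega>)" and pq: "k * (p \<bullet> \<nu> a) + q \<bullet> \<nu> a = 0"
      using bc[OF af] unfolding H_def[abs_def] by blast
    have m_lim: "(m \<longlongrightarrow> mb a) (at a within \<Omega>)"
    proof (rule Lim_transform_eventually)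
      show "(mb \<longlongrightarrow> mb a) (at a within \<Omega>)"
        using mb(1) a(1) closure_subset unfolding continuous_on_def A_def
        by (blast intro: tendsto_within_subset)
      show "\<forall>\<^sub>F x in at a within \<Omega>. mb x = m x"
        using mb(2) by (simp add: eventually_at_filter)
    qed
    have mba: "mb a \<ge> s" using a(1) by (simp add: A_def)
    then have mba0: "mb a \<noteq> 0" using s by auto
    have \<beta>_lim: "(\<beta> \<longlongrightarrow> inverse (mb a) *\<^sub>R p) (at a within \<Omega>)"
      unfolding \<beta>_def by (intro tendsto_intros m_lim p mba0)
    define K where "K = norm (inverse (mb a) *\<^sub>R p) + 1"
    have "\<forall>\<^sub>F x in at a within \<Omega>. norm (\<beta> x) < K"
      by (rule order_tendstoD(2)[OF tendsto_norm[OF \<beta>_lim]]) (simp add: K_def)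
    then obtain d where d: "d > 0" "\<And>x. x \<in> \<Omega> \<Longrightarrow> x \<noteq> a \<Longrightarrow> dist x a < d \<Longrightarrow> norm (\<beta> x) < K"
      unfolding eventually_at by blast
    define R where "R = min R0 (d / 2)"
    have R: "R > 0" "R \<le> R0" "2 * R \<le> d" using R0 d by (auto simp: R_def)
    define y where "y = a - R *\<^sub>R \<nu> a"
    have ya: "y - a = - (R *\<^sub>R \<nu> a)" "dist y a = R"
      using \<nu>(1)[OF af] R by (auto simp: y_def dist_norm)
    have ball: "ball y R \<subseteq> \<Omega>"
    proof -
      have "dist (a - R0 *\<^sub>R \<nu> a) y = R0 - R"
      proof -
        have "(a - R0 *\<^sub>R \<nu> a) - y = (R - R0) *\<^sub>R \<nu> a" by (simp add: y_def scaleR_diff_left)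
        then show ?thesis using \<nu>(1)[OF af] R by (simp add: dist_norm)
      qed
      then have "ball y R \<subseteq> ball (a - R0 *\<^sub>R \<nu> a) R0"
        using R by (simp add: ball_subset_ball_iff dist_commute)
      then show ?thesis using R0 by blast
    qed
    interpret elliptic_ball u U "\<lambda>x b. partial b U x" \<beta> K M R y
    proof
      fix x assume x: "x \<in> ball y R"
      then have x\<Omega>: "x \<in> \<Omega>" using ball by blast
      then show "GDERIV u x :> U x" "(U has_derivative (\<lambda>b. partial b U x)) (at x)"
        "(\<Sum>b\<in>Basis. partial b U x \<bullet> b) + \<beta> x \<bullet> U x = 0" "u x < M"
        using u U elliptic less by blast+
      have "dist x a < d" using dist_triangle[of x a y] x ya R by (simp add: dist_commute)
      then show "norm (\<beta> x) \<le> K" using d(2)[OF x\<Omega>] x\<Omega> \<open>a \<notin> \<Omega>\<close> by force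
    qed (rule R)
    show False
    proof (rule hopf_contradiction[OF ya(2)])
      have "(ub \<longlongrightarrow> M) (at a within D)"
        using ub_cont a(1) AD unfolding continuous_on_def M_def by blast
      then have "(ub \<longlongrightarrow> M) (at a within \<Omega>)" using D by (rule tendsto_within_subset)
      then have "(u \<longlongrightarrow> M) (at a within \<Omega>)"
        by (rule Lim_transform_eventually) (use ub in \<open>simp add: eventually_at_filter\<close>)
      then show "(u \<longlongrightarrow> M) (at a within ball y R)" using ball by (rule tendsto_within_subset)
      have "((\<lambda>x. inverse (m x) * ((k *\<^sub>R grad m x + m x *\<^sub>R grad H x) \<bullet> (y - a)))
          \<longlongrightarrow> inverse (mb a) * ((k *\<^sub>R p + q) \<bullet> (y - a))) (at a within \<Omega>)"
        by (intro tendsto_intros m_lim p q mba0)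
      moreover have "(k *\<^sub>R p + q) \<bullet> (y - a) = - R * (k * (p \<bullet> \<nu> a) + q \<bullet> \<nu> a)"
        by (simp add: ya inner_add_left algebra_simps)
      ultimately have "((\<lambda>x. inverse (m x) * ((k *\<^sub>R grad m x + m x *\<^sub>R grad H x) \<bullet> (y - a))) \<longlongrightarrow> 0)
          (at a within \<Omega>)"
        using pq by simp
      then have "((\<lambda>x. U x \<bullet> (y - a)) \<longlongrightarrow> 0) (at a within \<Omega>)"
      proof (rule Lim_transform_eventually)
        have "inverse (m x) * ((k *\<^sub>R grad m x + m x *\<^sub>R grad H x) \<bullet> (y - a)) = U x \<bullet> (y - a)"
          if "x \<in> \<Omega>" for x
          using pos[OF that] by (subst flux[OF that]) simp
        then show "\<forall>\<^sub>F x in at a within \<Omega>.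
            inverse (m x) * ((k *\<^sub>R grad m x + m x *\<^sub>R grad H x) \<bullet> (y - a)) = U x \<bullet> (y - a)"
          by (simp add: eventually_at_filter)
      qed
      then show "((\<lambda>x. U x \<bullet> (y - a)) \<longlongrightarrow> 0) (at a within ball y R)"
        using ball by (rule tendsto_within_subset)
    qed
  qed
  then obtain x2 where "x2 \<in> \<Omega>" "u x2 = M" by blast
  show thesis
  proof (rule that)
    fix x assume "x \<in> \<Omega>"
    then show "k * ln (m x) + h x (m x) = M"
      using smp[of x2 x] \<open>x2 \<in> \<Omega>\<close> \<open>u x2 = M\<close> by (simp add: u_def)
  qed
qed

end


section \<open>The family of functions with constant first integral\<close>

context brs_data
begin

text \<open>The function \<open>h\<close> on pairs, to which the hypotheses on derivatives refer.\<close>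

abbreviation f :: "'a \<times> real \<Rightarrow> real" where
  "f \<equiv> \<lambda>(x, s). h x s"

text \<open>The first integral as a function of position and value, extended to the closure of the domain.\<close>

definition G :: "'a \<Rightarrow> real \<Rightarrow> real" where
  "G x s = k * ln s + F (x, s)"

text \<open>
  The value at \<open>x\<close> of the function with first integral \<open>c\<close>; existence and uniqueness are
  proved for \<open>x \<in> closure \<Omega>\<close> below.
\<close>

definition sol :: "'a \<Rightarrow> real \<Rightarrow> real" where
  "sol x c = (THE s. 0 < s \<and> G x s = c)"

lemma F_mono:
  assumes x: "x \<in> closure \<Omega>" and "0 < s" "s \<le> t"
  shows "F (x, s) \<le> F (x, t)"
proof -
  obtain X where X: "\<And>n. X n \<in> \<Omega>" "X \<longlonglongrightarrow> x"
    using x closure_sequential by blast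
  have lim: "(\<lambda>n. F (X n, r)) \<longlonglongrightarrow> F (x, r)" if "r > 0" for r
    using that x X closure_subset
    by (intro continuous_on_tendsto_compose[OF F] tendsto_Pair) (auto intro!: always_eventually)
  show ?thesis
  proof (rule LIMSEQ_le[OF lim lim])
    show "\<exists>N. \<forall>n\<ge>N. F (X n, s) \<le> F (X n, t)"
      using mono[OF X(1)] F_eq X(1) assms(2,3) by (auto simp: mono_on_def)
  qed (use assms in auto)
qed

lemma G_strict_mono:
  assumes "x \<in> closure \<Omega>" "0 < s" "s < t"
  shows "G x s < G x t"
proof -
  have "k * ln s < k * ln t" using k assms by simp
  then show ?thesis using F_mono[of x s t] assms by (simp add: G_def)
qed

lemma G_continuous: "x \<in> closure \<Omega> \<Longrightarrow> continuous_on {0<..} (G x)"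
  unfolding G_def
  by (intro continuous_intros continuous_on_compose2[OF F]) auto

lemma G_surj:
  assumes x: "x \<in> closure \<Omega>"
  shows "\<exists>s>0. G x s = c"
proof -
  \<comment> \<open>The solution of \<open>k ln s + F (x, 1) = c\<close>: the root lies between \<open>s\<close> and \<open>1\<close>.\<close>
  define s where "s = exp ((c - F (x, 1)) / k)"
  have s: "s > 0" "k * ln s = c - F (x, 1)" using k by (simp_all add: s_def)
  have cont: "continuous_on {a..b} (G x)" if "a > 0" for a b
    using that by (intro continuous_on_subset[OF G_continuous[OF x]]) auto
  show ?thesis
  proof (cases "s \<le> 1")
    case True
    then have "k * ln s \<le> 0" using k s(1) by (simp add: mult_nonneg_nonpos)
    then have "G x s \<le> c" "c \<le> G x 1"
      using s F_mono[OF x s(1) True] by (auto simp: G_def)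
    then obtain r where "s \<le> r" "G x r = c" using IVT'[of "G x" s c 1] cont s True by auto
    then show ?thesis using s by (intro exI[of _ r]) auto
  next
    case False
    then have "k * ln s \<ge> 0" using k by simp
    then have "G x 1 \<le> c" "c \<le> G x s"
      using s F_mono[OF x, of 1 s] False by (auto simp: G_def)
    then obtain r where "1 \<le> r" "G x r = c" using IVT'[of "G x" 1 c s] cont False by auto
    then show ?thesis by (intro exI[of _ r]) auto
  qed
qed

lemma sol_unique:
  assumes "x \<in> closure \<Omega>" "0 < s" "G x s = c"
  shows "sol x c = s"
  unfolding sol_def
proof (rule the_equality)
  fix t assume "0 < t \<and> G x t = c"
  then show "t = s"
    using assms(2,3) G_strict_mono[OF assms(1), of s t] G_strict_mono[OF assms(1), of t s]
    by (cases t s rule: linorder_cases) auto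
qed (use assms in auto)

lemma sol:
  assumes "x \<in> closure \<Omega>"
  shows "sol x c > 0" "G x (sol x c) = c"
  using G_surj[OF assms, of c] sol_unique[OF assms] by auto

lemma less_sol_iff:
  assumes x: "x \<in> closure \<Omega>" and "0 < a"
  shows "a < sol x c \<longleftrightarrow> G x a < c" "sol x c < a \<longleftrightarrow> c < G x a"
proof -
  consider "a < sol x c" | "a = sol x c" | "sol x c < a" by linarith
  then have "(a < sol x c \<longleftrightarrow> G x a < c) \<and> (sol x c < a \<longleftrightarrow> c < G x a)"
  proof cases
    case 1
    then show ?thesis using G_strict_mono[OF x \<open>0 < a\<close>, of "sol x c"] sol[OF x, of c] by auto
  next
    case 2
    then show ?thesis using sol[OF x, of c] by auto
  next
    case 3
    then show ?thesis using G_strict_mono[OF x _ 3] sol[OF x, of c] by auto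
  qed
  then show "a < sol x c \<longleftrightarrow> G x a < c" "sol x c < a \<longleftrightarrow> c < G x a" by auto
qed

lemma sol_strict_mono:
  assumes x: "x \<in> closure \<Omega>" and "c < d"
  shows "sol x c < sol x d"
  using less_sol_iff(1)[OF x sol(1)[OF x], of c d] sol(2)[OF x] assms(2) by simp

text \<open>
  In \<open>c\<close>, the function \<open>ln (sol x c)\<close> is Lipschitz continuous with the constant \<open>1 / k\<close>, for all
  \<open>x\<close>. Hence the mass is continuous in \<open>c\<close>.
\<close>

lemma sol_upper:
  assumes x: "x \<in> closure \<Omega>" and "c \<le> d"
  shows "sol x d \<le> exp ((d - c) / k) * sol x c"
proof -
  let ?s = "sol x c"
  have s: "?s > 0" using sol[OF x] by blast
  have 1: "?s \<le> exp ((d - c) / k) * ?s"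
    using s assms k by (simp add: mult_le_cancel_right1)
  have "d = c + (d - c)" by simp
  also have "c + (d - c) \<le> G x (exp ((d - c) / k) * ?s)"
    using F_mono[OF x s 1] sol(2)[OF x, of c] s k
    by (simp add: G_def ln_mult_pos distrib_left)
  finally show ?thesis
    using less_sol_iff(1)[OF x, of "exp ((d - c) / k) * ?s" d] s by (simp add: not_less[symmetric])
qed

lemma sol_continuous: "continuous_on (closure \<Omega> \<times> UNIV) (\<lambda>(x, c). sol x c)"
proof -
  have "((\<lambda>(x, c). sol x c) \<longlongrightarrow> sol x c) (at (x, c) within closure \<Omega> \<times> UNIV)"
    if x: "x \<in> closure \<Omega>" for x c
  proof -
    let ?A = "at (x, c) within closure \<Omega> \<times> UNIV"
    have ev: "\<forall>\<^sub>F z in ?A. z \<in> closure \<Omega> \<times> UNIV"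
      by (simp add: eventually_at_filter)
    have lim: "((\<lambda>z. G (fst z) a - snd z) \<longlongrightarrow> G x a - c) ?A" if "a > 0" for a
    proof -
      have "continuous_on (closure \<Omega> \<times> UNIV) (\<lambda>z. F (fst z, a))"
        using that by (intro continuous_on_compose2[OF F] continuous_intros) auto
      then have "continuous_on (closure \<Omega> \<times> UNIV) (\<lambda>z. G (fst z) a - snd z)"
        unfolding G_def by (intro continuous_intros)
      then show ?thesis using x unfolding continuous_on_def by force
    qed
    show ?thesis
    proof (rule order_tendstoI)
      fix a assume a: "a < sol x c"
      show "\<forall>\<^sub>F z in ?A. a < (case z of (x, c) \<Rightarrow> sol x c)"
      proof (cases "a > 0")
        case True
        then have "G x a - c < 0" using less_sol_iff(1)[OF x True] a by simp
        from order_tendstoD(2)[OF lim[OF True] this] ev show ?thesis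
          by eventually_elim (auto simp: less_sol_iff True)
      next
        case False
        from ev show ?thesis
        proof eventually_elim
          case (elim z)
          then show ?case using False sol(1)[of "fst z" "snd z"] by (auto simp: case_prod_unfold)
        qed
      qed
    next
      fix a assume a: "sol x c < a"
      then have a0: "a > 0" using sol(1)[OF x, of c] by simp
      then have "G x a - c > 0" using less_sol_iff(2)[OF x a0] a by simp
      from order_tendstoD(1)[OF lim[OF a0] this] ev show "\<forall>\<^sub>F z in ?A. (case z of (x, c) \<Rightarrow> sol x c) < a"
        by eventually_elim (auto simp: less_sol_iff a0)
    qed
  qed
  then show ?thesis unfolding continuous_on_def by auto
qed

lemma sol_continuous_fixed: "continuous_on (closure \<Omega>) (\<lambda>x. sol x c)"
proof -
  have "continuous_on (closure \<Omega>) (\<lambda>x. case (x, c) of (x, c) \<Rightarrow> sol x c)"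
    by (rule continuous_on_compose2[OF sol_continuous]) (auto intro!: continuous_intros)
  then show ?thesis by simp
qed

lemma in_closure: "x \<in> \<Omega> \<Longrightarrow> x \<in> closure \<Omega>"
  using closure_subset by blast

lemma f_differentiable:
  assumes "x \<in> \<Omega>" "s > 0"
  shows "f differentiable (at (x, s))"
  using C2 assms unfolding Ck_on_2 by auto

lemma f_s_nonneg:
  assumes "x \<in> \<Omega>" "s > 0"
  shows "partial (0, 1) f (x, s) \<ge> 0"
proof -
  let ?D = "frechet_derivative f (at (x, s))"
  have D: "(f has_derivative ?D) (at (x, s))"
    using f_differentiable[OF assms] by (simp add: frechet_derivative_works)
  have "((\<lambda>t. (x, t)) has_derivative (\<lambda>t. (0, t))) (at s)"
    by (auto intro!: derivative_eq_intros)
  from has_derivative_compose[OF this D] have "(h x has_derivative (\<lambda>t. ?D (0, t))) (at s)"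
    by simp
  then have "(h x has_real_derivative partial (0, 1) f (x, s)) (at s)"
  proof (rule has_derivative_imp_has_field_derivative)
    fix t :: real
    show "t * partial (0, 1) f (x, s) = ?D (0, t)"
      using linear_scale[OF has_derivative_linear[OF D], of t "(0, 1)"] by (simp add: partial_def)
  qed
  then show ?thesis
    using assms(2) by (intro mono_on_imp_deriv_nonneg[OF mono[OF assms(1)], of _ s]) (simp_all add: interior_open)
qed

text \<open>
  The implicit function theorem, obtained from the derivative of the inverse of
  \<open>(x, s) \<mapsto> (x, k ln s + h(x, s))\<close>.
\<close>

lemma sol_differentiable:
  assumes x: "x \<in> \<Omega>"
  shows "(\<lambda>x. sol x c) differentiable (at x)"
proof -
  define s where "s = sol x c"
  have s: "s > 0" using sol in_closure[OF x] by (simp add: s_def)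
  define D where "D = frechet_derivative f (at (x, s))"
  have D: "(f has_derivative D) (at (x, s))"
    using f_differentiable[OF x s] by (simp add: D_def frechet_derivative_works)
  interpret D: linear D using D by (rule has_derivative_linear)
  define \<kappa> where "\<kappa> = k / s + D (0, 1)"
  have \<kappa>: "\<kappa> > 0" using f_s_nonneg[OF x s] k s by (simp add: \<kappa>_def D_def partial_def add_pos_nonneg)
  define \<Phi> where "\<Phi> z = (fst z, k * ln (snd z) + f z)" for z
  define g where "g z = (fst z, sol (fst z) (snd z))" for z
  have "(g has_derivative (\<lambda>(v, t). (v, (t - D (v, 0)) / \<kappa>))) (at (x, c))"
  proof (rule has_derivative_inverse_basic[where f = \<Phi> and T = "\<Omega> \<times> UNIV"
        and f' = "\<lambda>(v, t). (v, k / s * t + D (v, t))"])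
    have ln: "((\<lambda>z. k * ln (snd z)) has_derivative (\<lambda>w. k * (snd w / s))) (at (x, s))"
      using s by (auto intro!: derivative_eq_intros simp: field_simps)
    have "(\<Phi> has_derivative (\<lambda>w. (fst w, k * (snd w / s) + D w))) (at (x, s))"
      unfolding \<Phi>_def
      by (rule has_derivative_Pair[OF has_derivative_fst[OF has_derivative_ident] has_derivative_add[OF ln D]])
    then show "(\<Phi> has_derivative (\<lambda>(v, t). (v, k / s * t + D (v, t)))) (at (g (x, c)))"
      by (simp add: g_def s_def[symmetric] case_prod_unfold)
    have D0: "D (v + w, 0) = D (v, 0) + D (w, 0)" "D (r *\<^sub>R v, 0) = r * D (v, 0)" for v w r
      using D.add[of "(v, 0)" "(w, 0)"] D.scale[of r "(v, 0)"] by auto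
    have "linear (\<lambda>(v, t). (v, (t - D (v, 0)) / \<kappa>))"
      by (rule linearI) (auto simp: D0 diff_divide_distrib add_divide_distrib algebra_simps)
    then show "bounded_linear (\<lambda>(v, t). (v, (t - D (v, 0)) / \<kappa>))"
      by (simp add: linear_conv_bounded_linear)
    have split: "D (v, t) = D (v, 0) + t * D (0, 1)" for v t
      using D.add[of "(v, 0)" "(0, t)"] D.scale[of t "(0, 1)"] by simp
    have "k / s * t + D (v, t) - D (v, 0) = \<kappa> * t" for v t
      using split[of v t] by (simp add: \<kappa>_def algebra_simps)
    then show "(\<lambda>(v, t). (v, (t - D (v, 0)) / \<kappa>)) \<circ> (\<lambda>(v, t). (v, k / s * t + D (v, t))) = id"
      using \<kappa> by (auto simp: fun_eq_iff)
    show op: "open (\<Omega> \<times> (UNIV :: real set))" "(x, c) \<in> \<Omega> \<times> UNIV"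
      using \<Omega>(1) x by (simp_all add: open_Times)
    have "continuous_on (\<Omega> \<times> UNIV) (\<lambda>(x, c). sol x c)"
      by (rule continuous_on_subset[OF sol_continuous]) (use in_closure in auto)
    then have "continuous_on (\<Omega> \<times> UNIV) g"
      unfolding g_def case_prod_unfold by (intro continuous_intros)
    then show "isCont g (x, c)" using op continuous_on_eq_continuous_at by blast
    fix z assume "z \<in> \<Omega> \<times> (UNIV :: real set)"
    then show "\<Phi> (g z) = z"
      using sol[OF in_closure, of "fst z" "snd z"] F_eq
      by (auto simp: \<Phi>_def g_def G_def)
  qed
  then have "((\<lambda>z. snd (g z)) has_derivative (\<lambda>w. snd (case w of (v, t) \<Rightarrow> (v, (t - D (v, 0)) / \<kappa>)))) (at (x, c))"
    by (rule has_derivative_snd)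
  then have *: "((\<lambda>z. sol (fst z) (snd z)) has_derivative (\<lambda>w. snd (case w of (v, t) \<Rightarrow> (v, (t - D (v, 0)) / \<kappa>)))) (at (x, c))"
    by (simp add: g_def)
  have "((\<lambda>x. (x, c)) has_derivative (\<lambda>v. (v, 0))) (at x)"
    by (auto intro!: derivative_eq_intros)
  from has_derivative_compose[OF this *] show ?thesis
    unfolding differentiable_def by auto
qed

lemma sol_flux:
  assumes x: "x \<in> \<Omega>"
  shows "sol x c *\<^sub>R grad (\<lambda>z. h z (sol z c)) x = - k *\<^sub>R grad (\<lambda>x. sol x c) x"
proof -
  have pos: "sol x c > 0" if "x \<in> \<Omega>" for x using sol in_closure that by blast
  have "GDERIV (\<lambda>x. k * ln (sol x c) + h x (sol x c)) x
      :> (k / sol x c) *\<^sub>R grad (\<lambda>x. sol x c) x + grad (\<lambda>z. h z (sol z c)) x"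
    by (rule first_integral_gradient[OF pos sol_differentiable[OF x] x])
  then have "grad (\<lambda>x. k * ln (sol x c) + h x (sol x c)) x
      = (k / sol x c) *\<^sub>R grad (\<lambda>x. sol x c) x + grad (\<lambda>z. h z (sol z c)) x"
    by (rule grad_eqI)
  moreover have "grad (\<lambda>x. k * ln (sol x c) + h x (sol x c)) x = grad (\<lambda>x. c) x"
    by (rule grad_cong_open[OF \<Omega>(1) x]) (use sol in_closure F_eq in \<open>force simp: G_def\<close>)
  moreover have "grad (\<lambda>x::'a. c) x = 0" by (rule grad_eqI) (simp add: gderiv_def)
  ultimately have "(k / sol x c) *\<^sub>R grad (\<lambda>x. sol x c) x + grad (\<lambda>z. h z (sol z c)) x = 0"
    by simp
  then have "sol x c *\<^sub>R ((k / sol x c) *\<^sub>R grad (\<lambda>x. sol x c) x + grad (\<lambda>z. h z (sol z c)) x) = 0"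
    by simp
  then show ?thesis
    using pos[OF x] by (simp add: scaleR_add_right add_eq_0_iff)
qed

text \<open>
  As a function of \<open>x\<close> and \<open>s = sol x c\<close>, the right-hand side is continuously differentiable in the
  interior and extends continuously to the boundary. So \<open>sol\<close> has second derivatives in the interior
  and first derivatives up to the boundary.
\<close>

lemma sol_partial:
  assumes x: "x \<in> \<Omega>" and b: "b \<in> Basis"
  shows "partial b (\<lambda>x. sol x c) x
    = - partial (b, 0) f (x, sol x c) / (k / sol x c + partial (0, 1) f (x, sol x c))"
proof -
  have s: "sol x c > 0" using sol in_closure x by blast
  have "sol x c * (grad (\<lambda>z. h z (sol z c)) x \<bullet> b) = - k * (grad (\<lambda>x. sol x c) x \<bullet> b)"
    using arg_cong[OF sol_flux[OF x], of "\<lambda>v. v \<bullet> b"] by simp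
  then have 1: "sol x c * partial b (\<lambda>z. h z (sol z c)) x = - k * partial b (\<lambda>x. sol x c) x"
    by (simp add: grad_inner_Basis[OF b])
  have 2: "partial b (\<lambda>z. h z (sol z c)) x
      = partial (b, 0) f (x, sol x c) + partial (0, 1) f (x, sol x c) * partial b (\<lambda>x. sol x c) x"
    using partial_graph(2)[OF f_differentiable[OF x s] sol_differentiable[OF x]] by simp
  have "k / sol x c + partial (0, 1) f (x, sol x c) > 0"
    using f_s_nonneg[OF x s] k s by (simp add: add_pos_nonneg)
  moreover have "(k / sol x c + partial (0, 1) f (x, sol x c)) * partial b (\<lambda>x. sol x c) x = - partial (b, 0) f (x, sol x c)"
    using 1 s unfolding 2 by (simp add: field_simps)
  ultimately show ?thesis by (simp add: field_simps)
qed

lemma sol_C1: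
  "C1_upto \<Omega> (closure \<Omega>) (\<lambda>x. sol x c)" "Ck_on 1 \<Omega> (\<lambda>x. sol x c)"
proof -
  have ext: "\<exists>P. continuous_on (closure \<Omega>) P \<and> (\<forall>x\<in>\<Omega>. P x = partial b (\<lambda>x. sol x c) x)"
    if b: "b \<in> Basis" for b
  proof -
    have B: "(b, 0) \<in> Basis" "(0, 1::real) \<in> (Basis :: ('a \<times> real) set)"
      using b by (auto simp: Basis_prod_def)
    obtain Fb where Fb: "continuous_on (closure \<Omega> \<times> {0<..}) Fb"
      "\<And>x s. x \<in> \<Omega> \<Longrightarrow> s > 0 \<Longrightarrow> Fb (x, s) = partial (b, 0) f (x, s)"
      using F_partial[OF B(1)] unfolding extends_continuously_def by auto
    obtain Fs where Fs: "continuous_on (closure \<Omega> \<times> {0<..}) Fs"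
      "\<And>x s. x \<in> \<Omega> \<Longrightarrow> s > 0 \<Longrightarrow> Fs (x, s) = partial (0, 1) f (x, s)"
      using F_partial[OF B(2)] unfolding extends_continuously_def by auto
    have Fs_nonneg: "Fs (x, s) \<ge> 0" if x: "x \<in> closure \<Omega>" and s: "s > 0" for x s
    proof -
      obtain X where X: "\<And>n. X n \<in> \<Omega>" "X \<longlonglongrightarrow> x"
        using x closure_sequential by blast
      have "(\<lambda>n. Fs (X n, s)) \<longlonglongrightarrow> Fs (x, s)"
        using s x X in_closure
        by (intro continuous_on_tendsto_compose[OF Fs(1)] tendsto_Pair) (auto intro!: always_eventually)
      then show ?thesis
        by (rule LIMSEQ_le_const) (use X Fs(2) s f_s_nonneg in auto)
    qed
    have pos: "sol x c > 0" if "x \<in> closure \<Omega>" for x using sol that by blast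
    have denom: "k / sol x c + Fs (x, sol x c) \<noteq> 0" if "x \<in> closure \<Omega>" for x
      using Fs_nonneg[OF that pos[OF that]] pos[OF that] k
      by (smt (verit) divide_pos_pos)
    have comp: "continuous_on (closure \<Omega>) (\<lambda>x. P (x, sol x c))"
      if "continuous_on (closure \<Omega> \<times> {0<..}) P" for P :: "'a \<times> real \<Rightarrow> real"
      by (rule continuous_on_compose2[OF that continuous_on_Pair[OF continuous_on_id sol_continuous_fixed]])
        (use pos in auto)
    have "continuous_on (closure \<Omega>) (\<lambda>x. - Fb (x, sol x c) / (k / sol x c + Fs (x, sol x c)))"
      using denom pos
      by (intro continuous_intros comp Fb(1) Fs(1) sol_continuous_fixed) force+
    moreover have "- Fb (x, sol x c) / (k / sol x c + Fs (x, sol x c)) = partial b (\<lambda>x. sol x c) x"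
      if "x \<in> \<Omega>" for x
      using sol_partial[OF that b] Fb(2)[OF that] Fs(2)[OF that] pos[OF in_closure[OF that]] by simp
    ultimately show ?thesis by blast
  qed
  then show "C1_upto \<Omega> (closure \<Omega>) (\<lambda>x. sol x c)"
    using sol_differentiable sol_continuous_fixed unfolding C1_upto_def extends_continuously_def by blast
  have "continuous_on \<Omega> (partial b (\<lambda>x. sol x c))" if "b \<in> Basis" for b
    using ext[OF that] continuous_on_subset closure_subset continuous_on_eq by metis
  then show "Ck_on 1 \<Omega> (\<lambda>x. sol x c)"
    using sol_differentiable unfolding Ck_on_1 by blast
qed

lemma sol_C2: "Ck_on 2 \<Omega> (\<lambda>x. sol x c)"
proof -
  have "Ck_on 1 \<Omega> (partial b (\<lambda>x. sol x c))" if b: "b \<in> Basis" for b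
  proof (rule Ck_on_cong[OF \<Omega>(1)])
    define P where "P z = - 1 * partial (b, 0) f z * inverse (k * inverse (snd z) + partial (0, 1) f z)" for z
    let ?T = "\<Omega> \<times> {0::real<..}"
    have B: "(b, 0) \<in> Basis" "(0, 1::real) \<in> (Basis :: ('a \<times> real) set)"
      using b by (auto simp: Basis_prod_def)
    have const: "Ck_on 1 ?T (\<lambda>z. a)" for a :: real
    proof -
      have *: "((\<lambda>z. a) has_derivative (\<lambda>_. 0)) (at z)" for z :: "'a \<times> real" by simp
      have "partial b (\<lambda>z. a) = (\<lambda>z. 0)" for b :: "'a \<times> real"
        using partial_eqI[OF *] by blast
      then show ?thesis unfolding Ck_on_1 by simp
    qed
    have inv: "Ck_on 1 {0<..} (inverse :: real \<Rightarrow> real)"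
      by (rule Ck_on_1_real[where f' = "\<lambda>x. - (inverse x * inverse x)"])
        (auto intro!: derivative_eq_intros continuous_intros)
    have snd: "Ck_on 1 ?T snd"
    proof -
      have *: "(snd has_derivative snd) (at z)" for z :: "'a \<times> real"
        by (rule has_derivative_snd[OF has_derivative_ident])
      have "partial b snd = (\<lambda>z. snd b)" for b :: "'a \<times> real"
        using partial_eqI[OF *] by blast
      moreover have "snd differentiable (at z)" for z :: "'a \<times> real"
        using * differentiable_def by blast
      ultimately show ?thesis unfolding Ck_on_1 by simp
    qed
    have "Ck_on 1 ?T (\<lambda>z. inverse (snd z))"
      by (rule Ck_on_1_compose[OF inv snd]) auto
    moreover have f1: "Ck_on 1 ?T (partial (b, 0) f)" "Ck_on 1 ?T (partial (0, 1) f)"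
      using C2 B unfolding Ck_on_2 by blast+
    ultimately have "Ck_on 1 ?T (\<lambda>z. k * inverse (snd z) + partial (0, 1) f z)"
      by (intro Ck_on_1_add Ck_on_1_mult const)
    then have "Ck_on 1 ?T (\<lambda>z. inverse (k * inverse (snd z) + partial (0, 1) f z))"
    proof (rule Ck_on_1_compose[OF inv])
      fix z assume "z \<in> ?T"
      then have "partial (0, 1) f z \<ge> 0" "snd z > 0" using f_s_nonneg by auto
      then show "k * inverse (snd z) + partial (0, 1) f z \<in> {0<..}"
        using k by (simp add: add_pos_nonneg)
    qed
    then have "Ck_on 1 ?T P"
      unfolding P_def by (intro Ck_on_1_mult const f1)
    then show "Ck_on 1 \<Omega> (\<lambda>x. P (x, sol x c))"
      by (rule Ck_on_1_compose_graph[OF _ sol_C1(2)]) (use sol in_closure in auto)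
    fix x assume "x \<in> \<Omega>"
    then show "P (x, sol x c) = partial b (\<lambda>x. sol x c) x"
      using sol_partial[OF _ b, of x c] by (simp add: P_def divide_inverse)
  qed
  then show ?thesis using sol_differentiable unfolding Ck_on_2 by blast
qed

lemma sol_integrable: "(\<lambda>x. sol x c) integrable_on \<Omega>"
proof -
  have "compact ((\<lambda>x. sol x c) ` closure \<Omega>)"
    using \<Omega>(3) by (intro compact_continuous_image sol_continuous_fixed) simp
  then obtain N where N: "\<forall>v\<in>(\<lambda>x. sol x c) ` closure \<Omega>. norm v \<le> N"
    using compact_imp_bounded bounded_iff by metis
  have meas: "\<Omega> \<in> lmeasurable" using lmeasurable_open \<Omega> by blast
  show ?thesis
  proof (rule measurable_bounded_by_integrable_imp_integrable)
    show "(\<lambda>x. sol x c) \<in> borel_measurable (lebesgue_on \<Omega>)"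
      using meas continuous_on_subset[OF sol_continuous_fixed closure_subset]
      by (intro continuous_imp_measurable_on_sets_lebesgue) auto
    show "(\<lambda>x. N) integrable_on \<Omega>" by (rule integrable_on_const[OF meas])
  qed (use N in_closure meas in auto)
qed

lemma mass_one_exists: "\<exists>c. ((\<lambda>x. sol x c) has_integral 1) \<Omega>"
proof -
  define I where "I c = integral \<Omega> (\<lambda>x. sol x c)" for c
  have meas: "\<Omega> \<in> lmeasurable" using lmeasurable_open \<Omega> by blast
  define V where "V = measure lebesgue \<Omega>"
  have V: "V > 0"
    using open_not_negligible[OF \<Omega>(1,4)] negligible_iff_measure0[OF meas] by (simp add: V_def zero_less_measure_iff)
  have const: "integral \<Omega> (\<lambda>x. a) = a * V" for a :: real
    using integral_mult_right[of \<Omega> a "\<lambda>x. 1"] lmeasure_integral[OF meas] by (simp add: V_def)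
  have mono_I: "I c \<le> I d" if "c \<le> d" for c d
    unfolding I_def using that sol_strict_mono[OF in_closure]
    by (intro integral_le sol_integrable) (metis order_le_less)
  have upper_I: "I d \<le> exp ((d - c) / k) * I c" if "c \<le> d" for c d
  proof -
    have "I d \<le> integral \<Omega> (\<lambda>x. exp ((d - c) / k) * sol x c)"
      unfolding I_def using that sol_upper[OF in_closure]
      by (intro integral_le sol_integrable integrable_on_mult_right) auto
    then show ?thesis by (simp add: I_def)
  qed
  have cont: "isCont I c" for c
    unfolding isCont_def
  proof (rule tendsto_sandwich)
    have pos: "0 \<le> I c" for c
      unfolding I_def using sol(1)[OF in_closure] by (intro integral_nonneg sol_integrable) (auto intro: less_imp_le)
    have "exp (- \<bar>d - c\<bar> / k) * I c \<le> I d \<and> I d \<le> exp (\<bar>d - c\<bar> / k) * I c" for d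
    proof (cases "c \<le> d")
      case True
      have "exp (- \<bar>d - c\<bar> / k) * I c \<le> 1 * I c"
        using k by (intro mult_right_mono pos) auto
      then show ?thesis using mono_I[OF True] upper_I[OF True] True by simp
    next
      case False
      then have le: "I c \<le> exp ((c - d) / k) * I d" "I d \<le> I c"
        using mono_I[of d c] upper_I[of d c] by auto
      have abs: "- \<bar>d - c\<bar> / k = - ((c - d) / k)" "\<bar>d - c\<bar> / k = (c - d) / k" using False by (simp_all add: minus_divide_left)
      have "exp (- ((c - d) / k)) * I c \<le> exp (- ((c - d) / k)) * (exp ((c - d) / k) * I d)"
        using le(1) by (rule mult_left_mono) simp
      also have "\<dots> = I d" by (simp add: exp_minus)
      finally have "exp (- ((c - d) / k)) * I c \<le> I d" .
      moreover have "1 * I c \<le> exp ((c - d) / k) * I c"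
        using k False by (intro mult_right_mono pos) auto
      ultimately show ?thesis unfolding abs using le(2) by simp
    qed
    then show "\<forall>\<^sub>F d in at c. exp (- \<bar>d - c\<bar> / k) * I c \<le> I d" "\<forall>\<^sub>F d in at c. I d \<le> exp (\<bar>d - c\<bar> / k) * I c"
      by auto
    have "((\<lambda>d. exp (- \<bar>d - c\<bar> / k) * I c) \<longlongrightarrow> exp (- \<bar>c - c\<bar> / k) * I c) (at c)"
      using k by (intro tendsto_intros) auto
    then show "((\<lambda>d. exp (- \<bar>d - c\<bar> / k) * I c) \<longlongrightarrow> I c) (at c)" by simp
    have "((\<lambda>d. exp (\<bar>d - c\<bar> / k) * I c) \<longlongrightarrow> exp (\<bar>c - c\<bar> / k) * I c) (at c)"
      using k by (intro tendsto_intros) auto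
    then show "((\<lambda>d. exp (\<bar>d - c\<bar> / k) * I c) \<longlongrightarrow> I c) (at c)" by simp
  qed
  \<comment> \<open>The constant density of mass one separates two members of the family.\<close>
  define s where "s = 1 / V"
  have s: "s > 0" "s * V = 1" using V by (auto simp: s_def)
  obtain N where N: "\<And>x. x \<in> \<Omega> \<Longrightarrow> \<bar>h x s\<bar> \<le> N" using bounded_h[OF s(1)] by blast
  define a where "a = k * ln s - (\<bar>N\<bar> + 1)"
  define b where "b = k * ln s + (\<bar>N\<bar> + 1)"
  have G: "a < G x s" "G x s < b" if "x \<in> \<Omega>" for x
    using N[OF that] F_eq[OF that s(1)] by (auto simp: G_def a_def b_def)
  have "sol x a \<le> s" "s \<le> sol x b" if "x \<in> \<Omega>" for x
    using less_sol_iff[OF in_closure[OF that] s(1)] G[OF that] by (simp_all add: less_imp_le)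
  then have "I a \<le> integral \<Omega> (\<lambda>x. s)" "integral \<Omega> (\<lambda>x. s) \<le> I b"
    unfolding I_def by (intro integral_le sol_integrable integrable_on_const[OF meas]; simp)+
  then have "I a \<le> 1" "1 \<le> I b" using const s by auto
  moreover have "a \<le> b" by (simp add: a_def b_def)
  ultimately obtain c where "I c = 1" using IVT[of I a 1 b] cont by auto
  then show ?thesis using sol_integrable[of c] has_integral_integral I_def by metis
qed

lemma mass_strict_mono:
  assumes "c < d" "((\<lambda>x. sol x c) has_integral p) \<Omega>" "((\<lambda>x. sol x d) has_integral q) \<Omega>"
  shows "p \<noteq> q"
proof
  assume "p = q"
  define w where "w x = sol x d - sol x c" for x
  have pos: "w x > 0" if "x \<in> \<Omega>" for x
    using sol_strict_mono[OF in_closure[OF that] assms(1)] by (simp add: w_def)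
  have w0: "(w has_integral 0) \<Omega>"
    using has_integral_diff[OF assms(3,2)] \<open>p = q\<close> by (simp add: w_def[abs_def])
  obtain x where x: "x \<in> \<Omega>" using \<Omega>(4) by blast
  obtain a b where ab: "x \<in> box a b" "cbox a b \<subseteq> \<Omega>"
    using open_contains_cbox[OF \<Omega>(1) x] by metis
  have cont: "continuous_on (cbox a b) w"
    unfolding w_def using ab(2) closure_subset
    by (intro continuous_intros continuous_on_subset[OF sol_continuous_fixed]) blast+
  then have int: "w integrable_on cbox a b" by (rule integrable_continuous)
  have "integral (cbox a b) w \<le> integral \<Omega> w"
    using w0 pos by (intro integral_subset_le ab int) (auto intro: less_imp_le)
  moreover have "integral (cbox a b) w \<ge> 0"
    using pos ab(2) by (intro integral_nonneg int) (auto intro: less_imp_le)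
  ultimately have "(w has_integral 0) (cbox a b)"
    using w0 int by (metis has_integral_integral integral_unique order_antisym)
  moreover have "0 \<le> w v" if "v \<in> box a b" for v
    using pos[of v] that ab(2) box_subset_cbox by (meson less_imp_le subsetD)
  ultimately have "w x = 0"
    using ab(1) box_subset_cbox by (intro has_integral_0_cbox_imp_0[OF cont]) blast+
  then show False using pos[OF x] by simp
qed

end


section \<open>Existence and uniqueness\<close>

theorem theorem3p6:
  fixes \<sigma> \<alpha> :: real
    and \<Omega> :: "'a::euclidean_space set"
    and \<nu> :: "'a \<Rightarrow> 'a"
    and h :: "'a \<Rightarrow> real \<Rightarrow> real"
  assumes "\<sigma> > 0"
    and "open \<Omega>" and "connected \<Omega>" and "bounded \<Omega>" and "\<Omega> \<noteq> {}"
    and "0 < \<alpha>" and "\<alpha> < 1" and "Ck_holder_boundary 2 \<alpha> \<Omega>"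
    and "\<forall>x\<in>frontier \<Omega>. outer_unit_normal \<Omega> x (\<nu> x)"
    and "\<forall>x\<in>\<Omega>. mono_on {0<..} (h x)"
    and "\<exists>g. continuous_on {0<..} g \<and> g \<in> {0<..} \<rightarrow> {0..} \<and>
             (\<forall>s>0. \<forall>x\<in>\<Omega>. \<bar>h x s\<bar> \<le> g s)"
    and "Ck_on 2 (\<Omega> \<times> {0<..}) (\<lambda>(x, s). h x s)"
    and "C1_upto (\<Omega> \<times> {0<..}) (closure \<Omega> \<times> {0<..}) (\<lambda>(x, s). h x s)"
    and "\<exists>f. continuous_on {0<..} f \<and> f \<in> {0<..} \<rightarrow> {0..} \<and>
             (\<forall>s>0. \<forall>x\<in>\<Omega>. norm (grad (\<lambda>y. h y s) x) \<le> f s)"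
  shows "\<exists>!m. m \<in> \<Omega> \<rightarrow>\<^sub>E {0<..} \<and> Ck_on 2 \<Omega> m \<and> C1_upto \<Omega> (closure \<Omega>) m \<and>
              BRS_equation \<sigma> h \<Omega> m \<and> BRS_boundary \<sigma> h \<Omega> \<nu> m \<and> (m has_integral 1) \<Omega>"
proof -
  define k where "k = \<sigma>\<^sup>2 / 2"
  obtain F where F: "continuous_on (closure \<Omega> \<times> {0<..}) F"
    "\<And>x s. x \<in> \<Omega> \<Longrightarrow> s > 0 \<Longrightarrow> F (x, s) = h x s"
    using assms(13) unfolding C1_upto_def extends_continuously_def by force
  interpret brs_data k \<Omega> h F
  proof
    show "k > 0" using assms(1) by (simp add: k_def)
    show "\<exists>N. \<forall>x\<in>\<Omega>. \<bar>h x s\<bar> \<le> N" if "s > 0" for s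
      using assms(11) that by blast
    show "extends_continuously (\<Omega> \<times> {0<..}) (closure \<Omega> \<times> {0<..}) (partial b (\<lambda>(x, s). h x s))"
      if "b \<in> Basis" for b
      using assms(13) that unfolding C1_upto_def by blast
  qed (use assms F in auto)
  have \<nu>: "norm (\<nu> x) = 1" "\<exists>R>0. ball (x - R *\<^sub>R \<nu> x) R \<subseteq> \<Omega>" if x: "x \<in> frontier \<Omega>" for x
  proof -
    have n: "outer_unit_normal \<Omega> x (\<nu> x)" using assms(9) x by blast
    then show "norm (\<nu> x) = 1" unfolding outer_unit_normal_def by blast
    show "\<exists>R>0. ball (x - R *\<^sub>R \<nu> x) R \<subseteq> \<Omega>"
      using interior_ball_at_boundary[OF assms(2,6,8) x n] by blast
  qed
  let ?P = "\<lambda>m. m \<in> \<Omega> \<rightarrow>\<^sub>E {0<..} \<and> Ck_on 2 \<Omega> m \<and> C1_upto \<Omega> (closure \<Omega>) m \<and>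
    BRS_equation \<sigma> h \<Omega> m \<and> BRS_boundary \<sigma> h \<Omega> \<nu> m \<and> (m has_integral 1) \<Omega>"
  show ?thesis
  proof (rule ex_ex1I)
    \<comment> \<open>The solution is the member of the family with mass one, made extensional.\<close>
    obtain c where c: "((\<lambda>x. sol x c) has_integral 1) \<Omega>" using mass_one_exists by blast
    define m where "m = restrict (\<lambda>x. sol x c) \<Omega>"
    have m: "sol x c = m x" if "x \<in> \<Omega>" for x using that by (simp add: m_def)
    have m2: "Ck_on 2 \<Omega> m" by (rule Ck_on_cong[OF \<Omega>(1) m sol_C2])
    have m1: "C1_upto \<Omega> (closure \<Omega>) m" by (rule C1_upto_cong[OF \<Omega>(1) m sol_C1(1)])
    have flux: "m x *\<^sub>R grad (\<lambda>z. h z (m z)) x = - k *\<^sub>R grad m x + 0" if x: "x \<in> \<Omega>" for x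
    proof -
      have "grad (\<lambda>z. h z (sol z c)) x = grad (\<lambda>z. h z (m z)) x"
        by (rule grad_cong_open[OF \<Omega>(1) x]) (simp add: m)
      moreover have "grad (\<lambda>x. sol x c) x = grad m x"
        by (rule grad_cong_open[OF \<Omega>(1) x m])
      ultimately show ?thesis using sol_flux[OF x, of c] m[OF x] by simp
    qed
    have "BRS_equation \<sigma> h \<Omega> m"
      unfolding BRS_equation_def
    proof
      fix x assume x: "x \<in> \<Omega>"
      have d: "grad m differentiable (at x)" using grad_differentiable[OF m2 x] .
      have "divergence (\<lambda>y. m y *\<^sub>R grad (\<lambda>z. h z (m z)) y) x = divergence (\<lambda>y. - k *\<^sub>R grad m y + 0) x"
        using flux by (rule divergence_cong_open[OF \<Omega>(1) x])
      also have "\<dots> = - k * divergence (grad m) x + divergence (\<lambda>_. 0) x"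
        by (rule divergence_scaleR_add[OF d]) simp
      also have "divergence (\<lambda>_. 0 :: 'a) x = 0"
        by (simp add: divergence_def partial_eqI[OF has_derivative_const])
      finally show "- (\<sigma>\<^sup>2 / 2) * laplacian m x - divergence (\<lambda>y. m y *\<^sub>R grad (\<lambda>z. h z (m z)) y) x = 0"
        by (simp add: divergence_grad[OF d] k_def)
    qed
    moreover have "BRS_boundary \<sigma> h \<Omega> \<nu> m"
      unfolding BRS_boundary_def
    proof
      fix x assume "x \<in> frontier \<Omega>"
      then have "x \<in> closure \<Omega>" by (simp add: frontier_def)
      then obtain p where p: "(grad m \<longlongrightarrow> p) (at x within \<Omega>)"
        using C1_upto_grad_limit[OF m1 closure_subset] by blast
      have "((\<lambda>y. - k *\<^sub>R grad m y) \<longlongrightarrow> - k *\<^sub>R p) (at x within \<Omega>)"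
        by (intro tendsto_intros p)
      then have "((\<lambda>y. m y *\<^sub>R grad (\<lambda>z. h z (m z)) y) \<longlongrightarrow> - k *\<^sub>R p) (at x within \<Omega>)"
        by (rule Lim_transform_eventually) (use flux in \<open>simp add: eventually_at_filter\<close>)
      moreover have "- (\<sigma>\<^sup>2 / 2) * (p \<bullet> \<nu> x) - (- k *\<^sub>R p) \<bullet> \<nu> x = 0" by (simp add: k_def)
      ultimately show "\<exists>p q. (grad m \<longlongrightarrow> p) (at x within \<Omega>) \<and>
          ((\<lambda>y. m y *\<^sub>R grad (\<lambda>z. h z (m z)) y) \<longlongrightarrow> q) (at x within \<Omega>) \<and>
          - (\<sigma>\<^sup>2 / 2) * (p \<bullet> \<nu> x) - q \<bullet> \<nu> x = 0"
        using p by blast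
    qed
    moreover have "m \<in> \<Omega> \<rightarrow>\<^sub>E {0<..}" using sol(1) in_closure by (auto simp: m_def)
    moreover have "(m has_integral 1) \<Omega>" by (rule has_integral_eq[OF m c])
    ultimately show "\<exists>m. ?P m" using m1 m2 by blast
  next
    have represent: "\<exists>c. \<forall>x\<in>\<Omega>. m x = sol x c" if m: "?P m" for m
    proof -
      have pos: "m x > 0" if "x \<in> \<Omega>" for x using m that by (auto simp: PiE_iff)
      have "k * laplacian m x + divergence (\<lambda>y. m y *\<^sub>R grad (\<lambda>z. h z (m z)) y) x = 0" if "x \<in> \<Omega>" for x
      proof -
        have "- (\<sigma>\<^sup>2 / 2) * laplacian m x - divergence (\<lambda>y. m y *\<^sub>R grad (\<lambda>z. h z (m z)) y) x = 0"
          using m that unfolding BRS_equation_def by blast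
        then show ?thesis by (simp add: k_def)
      qed
      moreover have "\<exists>p q. (grad m \<longlongrightarrow> p) (at x within \<Omega>) \<and>
          ((\<lambda>y. m y *\<^sub>R grad (\<lambda>z. h z (m z)) y) \<longlongrightarrow> q) (at x within \<Omega>) \<and> k * (p \<bullet> \<nu> x) + q \<bullet> \<nu> x = 0"
        if x: "x \<in> frontier \<Omega>" for x
      proof -
        obtain p q where "(grad m \<longlongrightarrow> p) (at x within \<Omega>)"
          "((\<lambda>y. m y *\<^sub>R grad (\<lambda>z. h z (m z)) y) \<longlongrightarrow> q) (at x within \<Omega>)"
          "- (\<sigma>\<^sup>2 / 2) * (p \<bullet> \<nu> x) - q \<bullet> \<nu> x = 0"
          using m x unfolding BRS_boundary_def by blast
        moreover from this(3) have "k * (p \<bullet> \<nu> x) + q \<bullet> \<nu> x = 0" by (simp add: k_def)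
        ultimately show ?thesis by blast
      qed
      ultimately obtain c where c: "\<And>x. x \<in> \<Omega> \<Longrightarrow> k * ln (m x) + h x (m x) = c"
        using first_integral_constant[of \<nu> m] \<nu> pos m by blast
      have "sol x c = m x" if "x \<in> \<Omega>" for x
        using sol_unique[OF in_closure[OF that] pos[OF that]] c[OF that] F_eq[OF that pos[OF that]]
        by (simp add: G_def)
      then show ?thesis by metis
    qed
    fix m n assume m: "?P m" and n: "?P n"
    obtain c d where cd: "\<And>x. x \<in> \<Omega> \<Longrightarrow> m x = sol x c" "\<And>x. x \<in> \<Omega> \<Longrightarrow> n x = sol x d"
      using represent[OF m] represent[OF n] by blast
    have "((\<lambda>x. sol x c) has_integral 1) \<Omega>" "((\<lambda>x. sol x d) has_integral 1) \<Omega>"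
      using has_integral_eq[of \<Omega> m "\<lambda>x. sol x c"] has_integral_eq[of \<Omega> n "\<lambda>x. sol x d"] cd m n by auto
    then have "c = d"
      using mass_strict_mono by (cases c d rule: linorder_cases) blast+
    then show "m = n"
      using m n cd by (intro PiE_ext[of m \<Omega> "\<lambda>_. {0<..}"]) auto
  qed
qed

end
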